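(* Let $d\in(0,1/2)$ and let $(X_n)_{n\in\mathbb{Z}}$ be a long-memory linear stationary process with $X_n=\sum_{j\ge 0}b_j\varepsilon_{n-j}$ and $\varepsilon_n=\sum_{j\ge 0}a_jX_{n-j}$, where, for every $\delta>0$, there are constants $C_1,C_2$ such that $|a_j|\le C_1j^{-d-1+\delta}$ and $|b_j|\le C_2j^{d-1+\delta}$ for all $j\ge1$ (full setting in the context). Let $$\widetilde{X'_k}(1)=-\sum_{j=1}^{k}a_jX_{k+1-j}.$$ Then, as $k\to+\infty$, $$\forall \delta>0,\qquad \mathbb{E}\Big[\big(X_{k+1}-\widetilde{X'_k}(1)\big)^2\Big]=\sigma_\varepsilon^2+\mathrm{O}(k^{-1+\delta}).$$ Furthermore, the rate $\mathrm{O}(k^{-1})$ is optimal in the following sense: if $(X_n)_{n\in\mathbb{Z}}$ is the fractionally integrated noise F($d$), then there is a constant $C\neq0$ (not depending on $k$) such that, as $k\to+\infty$, $$\mathbb{E}\Big[\big(X_{k+1}-\widetilde{X'_k}(1)\big)^2\Big]=\sigma_\varepsilon^2+Ck^{-1}+\mathrm{o}(k^{-1}).$$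
   Context: Setting: $(X_n)_{n\in\mathbb{Z}}$ is a real discrete-time weakly stationary process in $L^2$ with mean $0$ and autocovariance function $\sigma$. It is long-memory, i.e. $\sum_{k\in\mathbb{Z}}|\sigma(k)|=\infty$. It has an infinite moving average representation $X_n=\sum_{j=0}^{\infty}b_j\varepsilon_{n-j}$, where $(\varepsilon_n)_{n\in\mathbb{Z}}$ is a white noise of uncorrelated random variables with mean $0$ and variance $\sigma_\varepsilon^2$ and $(b_j)$ is square-summable, and an infinite autoregressive representation $\varepsilon_n=\sum_{j=0}^{\infty}a_jX_{n-j}$ with $(a_j)$ absolutely summable. The normalization is $a_0=b_0=1$. The constants $C_1,C_2$ may depend on $\delta$. The fractionally integrated noise F($d$), $d\in(0,1/2)$, is the stationary solution of $X_n=(1-B)^{-d}\varepsilon_n$, where $B$ is the backward shift operator and $(\varepsilon_n)$ is a white noise with variance $\sigma_\varepsilon^2$; its autoregressive coefficients are $a_j=\frac{\Gamma(j-d)}{\Gamma(j+1)\Gamma(-d)}$. *)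

theory Defs
  imports "HOL-Probability.Probability" "HOL-Library.Landau_Symbols"
begin

definition square_integrable :: "'a measure \<Rightarrow> ('a \<Rightarrow> real) \<Rightarrow> bool" where
  "square_integrable M Y \<longleftrightarrow>
     Y \<in> borel_measurable M \<and> integrable M (\<lambda>\<omega>. (Y \<omega>)\<^sup>2)"

definition covariance :: "'a measure \<Rightarrow> ('a \<Rightarrow> real) \<Rightarrow> ('a \<Rightarrow> real) \<Rightarrow> real" where
  "covariance M Y Z =
     integral\<^sup>L M (\<lambda>\<omega>. (Y \<omega> - integral\<^sup>L M Y) * (Z \<omega> - integral\<^sup>L M Z))"

definition weakly_stationary :: "'a measure \<Rightarrow> (int \<Rightarrow> 'a \<Rightarrow> real) \<Rightarrow> bool" where
  "weakly_stationary M X \<longleftrightarrow>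
     (\<forall>n. square_integrable M (X n)) \<and>
     (\<forall>n. integral\<^sup>L M (X n) = integral\<^sup>L M (X 0)) \<and>
     (\<forall>n k. covariance M (X n) (X (n + k)) = covariance M (X 0) (X k))"

definition autocovariance :: "'a measure \<Rightarrow> (int \<Rightarrow> 'a \<Rightarrow> real) \<Rightarrow> int \<Rightarrow> real" where
  "autocovariance M X k = covariance M (X 0) (X k)"

definition long_memory :: "'a measure \<Rightarrow> (int \<Rightarrow> 'a \<Rightarrow> real) \<Rightarrow> bool" where
  "long_memory M X \<longleftrightarrow> \<not> (\<lambda>k. \<bar>autocovariance M X k\<bar>) summable_on (UNIV :: int set)"

text \<open>The white noise has variance \<open>s\<^sup>2\<close>. The degenerate case \<open>s = 0\<close> is excluded: it would
  force the linear processes below to vanish almost surely.\<close>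

definition white_noise :: "'a measure \<Rightarrow> real \<Rightarrow> (int \<Rightarrow> 'a \<Rightarrow> real) \<Rightarrow> bool" where
  "white_noise M s \<epsilon> \<longleftrightarrow>
     s > 0 \<and>
     (\<forall>n. square_integrable M (\<epsilon> n)) \<and>
     (\<forall>n. integral\<^sup>L M (\<epsilon> n) = 0) \<and>
     (\<forall>n. covariance M (\<epsilon> n) (\<epsilon> n) = s\<^sup>2) \<and>
     (\<forall>m n. m \<noteq> n \<longrightarrow> covariance M (\<epsilon> m) (\<epsilon> n) = 0)"

text \<open>Convergence of a series of random variables in \<open>L\<^sup>2\<close>. Square integrability is required
  explicitly because the Bochner integral of a non-integrable function is \<open>0\<close>.\<close>

definition mean_square_sums :: "'a measure \<Rightarrow> (nat \<Rightarrow> 'a \<Rightarrow> real) \<Rightarrow> ('a \<Rightarrow> real) \<Rightarrow> bool" where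
  "mean_square_sums M Y S \<longleftrightarrow>
     (\<forall>j. square_integrable M (Y j)) \<and> square_integrable M S \<and>
     (\<lambda>n. integral\<^sup>L M (\<lambda>\<omega>. ((\<Sum>j<n. Y j \<omega>) - S \<omega>)\<^sup>2)) \<longlonglongrightarrow> 0"

text \<open>\<open>Y n = (\<Sum>j. c j * Z (n - j))\<close> for every \<open>n\<close>, i.e. \<open>Y\<close> arises from \<open>Z\<close> by applying the
  power series \<open>(\<Sum>j. c j * B ^ j)\<close> in the backward shift operator \<open>B\<close>.\<close>

definition backshift_series ::
  "'a measure \<Rightarrow> (nat \<Rightarrow> real) \<Rightarrow> (int \<Rightarrow> 'a \<Rightarrow> real) \<Rightarrow> (int \<Rightarrow> 'a \<Rightarrow> real) \<Rightarrow> bool" where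
  "backshift_series M c Z Y \<longleftrightarrow>
     (\<forall>n. mean_square_sums M (\<lambda>j \<omega>. c j * Z (n - int j) \<omega>) (Y n))"

definition long_memory_linear_process ::
  "'a measure \<Rightarrow> real \<Rightarrow> (int \<Rightarrow> 'a \<Rightarrow> real) \<Rightarrow> (int \<Rightarrow> 'a \<Rightarrow> real) \<Rightarrow>
    (nat \<Rightarrow> real) \<Rightarrow> (nat \<Rightarrow> real) \<Rightarrow> bool" where
  "long_memory_linear_process M s X \<epsilon> a b \<longleftrightarrow>
     weakly_stationary M X \<and> (\<forall>n. integral\<^sup>L M (X n) = 0) \<and> long_memory M X \<and>
     white_noise M s \<epsilon> \<and>
     summable (\<lambda>j. (b j)\<^sup>2) \<and> backshift_series M b \<epsilon> X \<and>
     summable (\<lambda>j. \<bar>a j\<bar>) \<and> backshift_series M a X \<epsilon> \<and>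
     a 0 = 1 \<and> b 0 = 1"

text \<open>The coefficients of the operator \<open>(1 - B) powr (- d)\<close> come from the binomial series of
  \<open>(1 - z) powr (- d)\<close>, see \<open>gen_binomial_real\<close>.\<close>

definition fractional_noise ::
  "'a measure \<Rightarrow> real \<Rightarrow> real \<Rightarrow> (int \<Rightarrow> 'a \<Rightarrow> real) \<Rightarrow> (int \<Rightarrow> 'a \<Rightarrow> real) \<Rightarrow> bool" where
  "fractional_noise M d s X \<epsilon> \<longleftrightarrow>
     weakly_stationary M X \<and> white_noise M s \<epsilon> \<and>
     backshift_series M (\<lambda>j. (-1) ^ j * ((- d) gchoose j)) \<epsilon> X"

definition fractional_ar_coeff :: "real \<Rightarrow> nat \<Rightarrow> real" where
  "fractional_ar_coeff d j = Gamma (real j - d) / (Gamma (real j + 1) * Gamma (- d))"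

text \<open>The one-step predictor of \<open>X (k + 1)\<close> from \<open>X 1, \<dots>, X k\<close> obtained by truncating the
  autoregressive representation.\<close>

definition truncated_predictor ::
  "(nat \<Rightarrow> real) \<Rightarrow> (int \<Rightarrow> 'a \<Rightarrow> real) \<Rightarrow> nat \<Rightarrow> 'a \<Rightarrow> real" where
  "truncated_predictor a X k \<omega> = - (\<Sum>j=1..k. a j * X (int k + 1 - int j) \<omega>)"

definition prediction_mse ::
  "'a measure \<Rightarrow> (nat \<Rightarrow> real) \<Rightarrow> (int \<Rightarrow> 'a \<Rightarrow> real) \<Rightarrow> nat \<Rightarrow> real" where
  "prediction_mse M a X k =
     integral\<^sup>L M (\<lambda>\<omega>. (X (int k + 1) \<omega> - truncated_predictor a X k \<omega>)\<^sup>2)"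

end

theory Submission
  imports Defs
begin

text \<open>The prediction error of the truncated predictor is the truncated autoregressive sum
\<open>a 0 * X (k + 1) + \<dots> + a k * X 1\<close>. Inserting the moving average representation of \<open>X\<close> makes it a
moving average of the white noise, whose coefficients \<open>c m\<close> are those of the power series of
\<open>b\<close> times the truncated series of \<open>a\<close>. By orthogonality the mean square error is \<open>s\<^sup>2\<close> times the sum of
the \<open>(c m)\<^sup>2\<close> (\<open>prediction_mse_sums\<close>). The two full power series are inverse to each other
(\<open>backshift_series_inverse\<close>), so \<open>c 0 = 1\<close> and \<open>c m = 0\<close> for \<open>0 < m \<le> k\<close>, and the excess of the error
over \<open>s\<^sup>2\<close> is carried by the degrees \<open>m > k\<close>.

For the upper bound, \<open>c (k + 1 + l)\<close> is, up to sign, the convolution of the tail \<open>a (k + 1 + i)\<close> with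
\<open>b (l - i)\<close>. Distributing the decay of the tail suitably between \<open>k\<close> and \<open>i\<close> gives
\<open>\<bar>c (k + 1 + l)\<bar> \<le> D * k powr (- 1 / 2 + 3 * h) * (l + 1) powr (- 1 / 2 - h)\<close> for small \<open>h\<close>, and the squares
of this sum to \<open>O(k powr (- 1 + 6 * h))\<close> (\<open>prediction_mse_bigo\<close>).

For fractional noise the coefficients are \<open>a j = (- 1) ^ j * (d gchoose j)\<close> and
\<open>b j = (- 1) ^ j * (- d gchoose j)\<close>, and Andersen's identity (\<open>gbinomial_partial_convolution\<close>) evaluates
\<open>c (k + l)\<close> exactly as \<open>l / (k + l) * (d - 1 gchoose k) * (- d gchoose l)\<close> up to sign. The
asymptotics of the binomial coefficients and a Riemann sum argument (\<open>weighted_series_asymptotics\<close>)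
then show that \<open>k\<close> times the excess converges to a positive constant.\<close>

section \<open>Convergence in mean square\<close>

lemma square_integrable_cmult:
  "square_integrable M U \<Longrightarrow> square_integrable M (\<lambda>\<omega>. c * U \<omega>)"
  by (auto simp: square_integrable_def power_mult_distrib)

lemma square_integrable_integrable_mult:
  assumes "square_integrable M U" "square_integrable M V"
  shows "integrable M (\<lambda>\<omega>. U \<omega> * V \<omega>)"
proof (rule Bochner_Integration.integrable_bound)
  show "integrable M (\<lambda>\<omega>. (U \<omega>)\<^sup>2 + (V \<omega>)\<^sup>2)"
    using assms by (simp add: square_integrable_def)
  show "(\<lambda>\<omega>. U \<omega> * V \<omega>) \<in> borel_measurable M"
    using assms by (auto simp: square_integrable_def)
  have "\<bar>x * y\<bar> \<le> x\<^sup>2 + y\<^sup>2" for x y :: real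
  proof -
    have "2 * \<bar>x\<bar> * \<bar>y\<bar> \<le> x\<^sup>2 + y\<^sup>2"
      using sum_squares_bound[of "\<bar>x\<bar>" "\<bar>y\<bar>"] by simp
    moreover have "0 \<le> \<bar>x\<bar> * \<bar>y\<bar>" by simp
    ultimately show ?thesis unfolding abs_mult by linarith
  qed
  then show "AE \<omega> in M. norm (U \<omega> * V \<omega>) \<le> norm ((U \<omega>)\<^sup>2 + (V \<omega>)\<^sup>2)"
    by simp
qed

lemma square_integrable_add:
  assumes "square_integrable M U" "square_integrable M V"
  shows "square_integrable M (\<lambda>\<omega>. U \<omega> + V \<omega>)"
proof -
  have "integrable M (\<lambda>\<omega>. (U \<omega>)\<^sup>2 + (V \<omega>)\<^sup>2 + 2 * (U \<omega> * V \<omega>))"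
    using assms square_integrable_integrable_mult[OF assms]
    by (simp add: square_integrable_def)
  then have "integrable M (\<lambda>\<omega>. (U \<omega> + V \<omega>)\<^sup>2)"
    by (simp add: power2_sum mult.assoc)
  then show ?thesis
    using assms by (auto simp: square_integrable_def)
qed

lemma square_integrable_diff:
  assumes "square_integrable M U" "square_integrable M V"
  shows "square_integrable M (\<lambda>\<omega>. U \<omega> - V \<omega>)"
  using square_integrable_add[OF assms(1) square_integrable_cmult[OF assms(2), of "-1"]]
  by simp

lemma square_integrable_sum:
  assumes "\<And>i. i \<in> I \<Longrightarrow> square_integrable M (U i)"
  shows "square_integrable M (\<lambda>\<omega>. \<Sum>i\<in>I. U i \<omega>)"
  using assms
proof (induction I rule: infinite_finite_induct)
  case (insert i I)
  then show ?case by (simp add: square_integrable_add)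
qed (simp_all add: square_integrable_def)

lemma integral_mult_sum_left:
  assumes "\<And>i. i \<in> I \<Longrightarrow> square_integrable M (U i)" "square_integrable M V"
  shows "(\<integral>\<omega>. (\<Sum>i\<in>I. c i * U i \<omega>) * V \<omega> \<partial>M) = (\<Sum>i\<in>I. c i * (\<integral>\<omega>. U i \<omega> * V \<omega> \<partial>M))"
proof -
  have "(\<integral>\<omega>. (\<Sum>i\<in>I. c i * U i \<omega>) * V \<omega> \<partial>M) = (\<integral>\<omega>. (\<Sum>i\<in>I. c i * (U i \<omega> * V \<omega>)) \<partial>M)"
    by (simp add: sum_distrib_right mult.assoc)
  also have "\<dots> = (\<Sum>i\<in>I. (\<integral>\<omega>. c i * (U i \<omega> * V \<omega>) \<partial>M))"
    using assms by (intro Bochner_Integration.integral_sum)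
      (auto intro: square_integrable_integrable_mult)
  finally show ?thesis by simp
qed

lemma Cauchy_Schwarz_integral_square:
  assumes "square_integrable M U" "square_integrable M V"
  shows "(\<integral>\<omega>. U \<omega> * V \<omega> \<partial>M)\<^sup>2 \<le> (\<integral>\<omega>. (U \<omega>)\<^sup>2 \<partial>M) * (\<integral>\<omega>. (V \<omega>)\<^sup>2 \<partial>M)"
proof -
  define A B C where "A = (\<integral>\<omega>. (U \<omega>)\<^sup>2 \<partial>M)" and "B = (\<integral>\<omega>. U \<omega> * V \<omega> \<partial>M)"
    and "C = (\<integral>\<omega>. (V \<omega>)\<^sup>2 \<partial>M)"
  note int = square_integrable_integrable_mult[OF assms] assms[unfolded square_integrable_def]
  have quad: "0 \<le> A - 2 * t * B + t\<^sup>2 * C" for t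
  proof -
    have "0 \<le> (\<integral>\<omega>. (U \<omega> - t * V \<omega>)\<^sup>2 \<partial>M)" by simp
    also have "\<dots> = (\<integral>\<omega>. (U \<omega>)\<^sup>2 - 2 * t * (U \<omega> * V \<omega>) + t\<^sup>2 * (V \<omega>)\<^sup>2 \<partial>M)"
      by (simp add: power2_diff power_mult_distrib algebra_simps)
    also have "\<dots> = A - 2 * t * B + t\<^sup>2 * C"
      using int by (simp add: A_def B_def C_def)
    finally show ?thesis .
  qed
  have "B\<^sup>2 \<le> A * C"
  proof (cases "C = 0")
    case True
    have "B = 0"
    proof (rule ccontr)
      assume "B \<noteq> 0"
      \<comment> \<open>For this value of \<open>t\<close> the linear function \<open>A - 2 * t * B\<close> equals \<open>- 1\<close>.\<close>
      then show False
        using quad[of "(A + 1) / (2 * B)"] True by simp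
    qed
    then show ?thesis using True by simp
  next
    case False
    then have "C > 0" by (simp add: C_def order.not_eq_order_implies_strict)
    have "0 \<le> A - B\<^sup>2 / C"
      using quad[of "B / C"] False by (simp add: power2_eq_square)
    then show ?thesis using \<open>C > 0\<close> by (simp add: field_simps)
  qed
  then show ?thesis by (simp add: A_def B_def C_def)
qed

text \<open>Convergence of an arbitrary sequence is needed next to \<open>mean_square_sums\<close>: delaying the series of
\<open>X (n - j)\<close> so that it runs over the noise \<open>\<epsilon> (n - m)\<close>, and adding several such series, changes
the number of terms in the partial sums.\<close>

definition mean_square_tendsto ::
  "'a measure \<Rightarrow> (nat \<Rightarrow> 'a \<Rightarrow> real) \<Rightarrow> ('a \<Rightarrow> real) \<Rightarrow> bool" where
  "mean_square_tendsto M U V \<longleftrightarrow>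
     (\<forall>n. square_integrable M (U n)) \<and> square_integrable M V \<and>
     (\<lambda>n. \<integral>\<omega>. (U n \<omega> - V \<omega>)\<^sup>2 \<partial>M) \<longlonglongrightarrow> 0"

lemma mean_square_tendsto_add:
  assumes "mean_square_tendsto M U V" "mean_square_tendsto M U' V'"
  shows "mean_square_tendsto M (\<lambda>n \<omega>. U n \<omega> + U' n \<omega>) (\<lambda>\<omega>. V \<omega> + V' \<omega>)"
proof -
  have le: "(\<integral>\<omega>. (U n \<omega> + U' n \<omega> - (V \<omega> + V' \<omega>))\<^sup>2 \<partial>M)
      \<le> 2 * (\<integral>\<omega>. (U n \<omega> - V \<omega>)\<^sup>2 \<partial>M) + 2 * (\<integral>\<omega>. (U' n \<omega> - V' \<omega>)\<^sup>2 \<partial>M)" for n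
  proof -
    have si: "square_integrable M (\<lambda>\<omega>. U n \<omega> - V \<omega>)"
      "square_integrable M (\<lambda>\<omega>. U' n \<omega> - V' \<omega>)"
      using assms by (auto simp: mean_square_tendsto_def intro: square_integrable_diff)
    have eq: "U n \<omega> + U' n \<omega> - (V \<omega> + V' \<omega>) = (U n \<omega> - V \<omega>) + (U' n \<omega> - V' \<omega>)" for \<omega>
      by simp
    have "(\<integral>\<omega>. ((U n \<omega> - V \<omega>) + (U' n \<omega> - V' \<omega>))\<^sup>2 \<partial>M)
        \<le> (\<integral>\<omega>. 2 * (U n \<omega> - V \<omega>)\<^sup>2 + 2 * (U' n \<omega> - V' \<omega>)\<^sup>2 \<partial>M)"
    proof (rule integral_mono)
      show "integrable M (\<lambda>\<omega>. ((U n \<omega> - V \<omega>) + (U' n \<omega> - V' \<omega>))\<^sup>2)"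
        using square_integrable_add[OF si] by (simp add: square_integrable_def)
      show "integrable M (\<lambda>\<omega>. 2 * (U n \<omega> - V \<omega>)\<^sup>2 + 2 * (U' n \<omega> - V' \<omega>)\<^sup>2)"
        using si by (simp add: square_integrable_def)
      fix \<omega>
      show "((U n \<omega> - V \<omega>) + (U' n \<omega> - V' \<omega>))\<^sup>2 \<le> 2 * (U n \<omega> - V \<omega>)\<^sup>2 + 2 * (U' n \<omega> - V' \<omega>)\<^sup>2"
        using sum_squares_bound[of "U n \<omega> - V \<omega>" "U' n \<omega> - V' \<omega>"]
        unfolding power2_sum by linarith
    qed
    then show ?thesis
      unfolding eq using si by (simp add: square_integrable_def)
  qed
  have "(\<lambda>n. 2 * (\<integral>\<omega>. (U n \<omega> - V \<omega>)\<^sup>2 \<partial>M) + 2 * (\<integral>\<omega>. (U' n \<omega> - V' \<omega>)\<^sup>2 \<partial>M)) \<longlonglongrightarrow> 0"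
    using assms by (intro tendsto_add_zero tendsto_mult_right_zero) (auto simp: mean_square_tendsto_def)
  then have "(\<lambda>n. \<integral>\<omega>. (U n \<omega> + U' n \<omega> - (V \<omega> + V' \<omega>))\<^sup>2 \<partial>M) \<longlonglongrightarrow> 0"
    by (rule Lim_null_comparison[rotated]) (simp add: le)
  then show ?thesis
    using assms by (auto simp: mean_square_tendsto_def intro: square_integrable_add)
qed

lemma mean_square_tendsto_cmult:
  assumes "mean_square_tendsto M U V"
  shows "mean_square_tendsto M (\<lambda>n \<omega>. c * U n \<omega>) (\<lambda>\<omega>. c * V \<omega>)"
proof -
  have "(\<lambda>n. c\<^sup>2 * (\<integral>\<omega>. (U n \<omega> - V \<omega>)\<^sup>2 \<partial>M)) \<longlonglongrightarrow> c\<^sup>2 * 0"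
    using assms by (intro tendsto_intros) (auto simp: mean_square_tendsto_def)
  moreover have "c\<^sup>2 * (\<integral>\<omega>. (U n \<omega> - V \<omega>)\<^sup>2 \<partial>M) = (\<integral>\<omega>. (c * U n \<omega> - c * V \<omega>)\<^sup>2 \<partial>M)" for n
    by (simp flip: right_diff_distrib add: power_mult_distrib)
  ultimately show ?thesis
    using assms by (auto simp: mean_square_tendsto_def intro: square_integrable_cmult)
qed

lemma mean_square_tendsto_sum:
  assumes "finite I" "\<And>i. i \<in> I \<Longrightarrow> mean_square_tendsto M (U i) (V i)"
  shows "mean_square_tendsto M (\<lambda>n \<omega>. \<Sum>i\<in>I. U i n \<omega>) (\<lambda>\<omega>. \<Sum>i\<in>I. V i \<omega>)"
  using assms
proof (induction I rule: finite_induct)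
  case empty
  show ?case by (simp add: mean_square_tendsto_def square_integrable_def)
next
  case (insert i I)
  then show ?case by (simp add: mean_square_tendsto_add)
qed

text \<open>Mean-square limits can be pulled out of inner products, by Cauchy-Schwarz. This turns
covariances of infinite moving averages into limits of finite sums.\<close>

lemma tendsto_integral_mult:
  assumes "mean_square_tendsto M U V" "square_integrable M W"
  shows "(\<lambda>n. \<integral>\<omega>. U n \<omega> * W \<omega> \<partial>M) \<longlonglongrightarrow> (\<integral>\<omega>. V \<omega> * W \<omega> \<partial>M)"
proof -
  have U: "square_integrable M (U n)" and V: "square_integrable M V" for n
    using assms by (auto simp: mean_square_tendsto_def)
  have le: "((\<integral>\<omega>. U n \<omega> * W \<omega> \<partial>M) - (\<integral>\<omega>. V \<omega> * W \<omega> \<partial>M))\<^sup>2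
      \<le> (\<integral>\<omega>. (U n \<omega> - V \<omega>)\<^sup>2 \<partial>M) * (\<integral>\<omega>. (W \<omega>)\<^sup>2 \<partial>M)" for n
  proof -
    have "(\<integral>\<omega>. U n \<omega> * W \<omega> \<partial>M) - (\<integral>\<omega>. V \<omega> * W \<omega> \<partial>M) = (\<integral>\<omega>. (U n \<omega> - V \<omega>) * W \<omega> \<partial>M)"
      using square_integrable_integrable_mult[OF U assms(2), of n]
        square_integrable_integrable_mult[OF V assms(2)]
      by (simp add: left_diff_distrib)
    then show ?thesis
      using Cauchy_Schwarz_integral_square[OF square_integrable_diff[OF U V] assms(2)] by simp
  qed
  have "(\<lambda>n. (\<integral>\<omega>. (U n \<omega> - V \<omega>)\<^sup>2 \<partial>M) * (\<integral>\<omega>. (W \<omega>)\<^sup>2 \<partial>M)) \<longlonglongrightarrow> 0"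
    using assms by (intro tendsto_mult_left_zero) (auto simp: mean_square_tendsto_def)
  then have "(\<lambda>n. ((\<integral>\<omega>. U n \<omega> * W \<omega> \<partial>M) - (\<integral>\<omega>. V \<omega> * W \<omega> \<partial>M))\<^sup>2) \<longlonglongrightarrow> 0"
    by (rule Lim_null_comparison[rotated]) (simp add: le)
  then have "(\<lambda>n. \<bar>(\<integral>\<omega>. U n \<omega> * W \<omega> \<partial>M) - (\<integral>\<omega>. V \<omega> * W \<omega> \<partial>M)\<bar>) \<longlonglongrightarrow> 0"
    using tendsto_real_sqrt by fastforce
  then show ?thesis
    by (simp add: tendsto_rabs_zero_iff LIM_zero_iff)
qed

text \<open>Write \<open>U\<^sup>2 = (U - V)\<^sup>2 + 2 * U * V - V\<^sup>2\<close>: the first term vanishes in the limit, and the mixed term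
is an inner product with the fixed variable \<open>V\<close>.\<close>

lemma tendsto_integral_square:
  assumes "mean_square_tendsto M U V"
  shows "(\<lambda>n. \<integral>\<omega>. (U n \<omega>)\<^sup>2 \<partial>M) \<longlonglongrightarrow> (\<integral>\<omega>. (V \<omega>)\<^sup>2 \<partial>M)"
proof -
  have U: "square_integrable M (U n)" and V: "square_integrable M V" for n
    using assms by (auto simp: mean_square_tendsto_def)
  have eq: "(\<integral>\<omega>. (U n \<omega>)\<^sup>2 \<partial>M) =
      (\<integral>\<omega>. (U n \<omega> - V \<omega>)\<^sup>2 \<partial>M) + 2 * (\<integral>\<omega>. U n \<omega> * V \<omega> \<partial>M) - (\<integral>\<omega>. V \<omega> * V \<omega> \<partial>M)" for n
  proof -
    have "(\<integral>\<omega>. (U n \<omega>)\<^sup>2 \<partial>M) = (\<integral>\<omega>. (U n \<omega> - V \<omega>)\<^sup>2 + 2 * (U n \<omega> * V \<omega>) - V \<omega> * V \<omega> \<partial>M)"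
      by (rule Bochner_Integration.integral_cong) (simp_all add: power2_eq_square algebra_simps)
    then show ?thesis
      using square_integrable_integrable_mult[OF U V, of n]
        square_integrable_integrable_mult[OF V V] square_integrable_diff[OF U V, of n]
      by (simp add: square_integrable_def)
  qed
  have "(\<lambda>n. \<integral>\<omega>. (U n \<omega>)\<^sup>2 \<partial>M) \<longlonglongrightarrow> 0 + 2 * (\<integral>\<omega>. V \<omega> * V \<omega> \<partial>M) - (\<integral>\<omega>. V \<omega> * V \<omega> \<partial>M)"
    unfolding eq using assms tendsto_integral_mult[OF assms V]
    by (intro tendsto_intros) (auto simp: mean_square_tendsto_def)
  then show ?thesis by (simp add: power2_eq_square)
qed

section \<open>The prediction error as a moving average of the noise\<close>

lemma backshift_series_tendsto:
  assumes "backshift_series M c Z Y"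
  shows "mean_square_tendsto M (\<lambda>N \<omega>. \<Sum>j<N. c j * Z (n - int j) \<omega>) (Y n)"
  using assms
  by (auto simp: backshift_series_def mean_square_sums_def mean_square_tendsto_def
      intro: square_integrable_sum)

lemma white_noise_integral_mult:
  assumes "white_noise M s \<epsilon>"
  shows "(\<integral>\<omega>. \<epsilon> m \<omega> * \<epsilon> n \<omega> \<partial>M) = (if m = n then s\<^sup>2 else 0)"
  using assms unfolding white_noise_def covariance_def by auto

lemma white_noise_square_sum:
  assumes "white_noise M s \<epsilon>"
  shows "(\<integral>\<omega>. (\<Sum>m<N. c m * \<epsilon> (n - int m) \<omega>)\<^sup>2 \<partial>M) = (\<Sum>m<N. s\<^sup>2 * (c m)\<^sup>2)"
proof -
  have si: "square_integrable M (\<epsilon> i)" for i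
    using assms by (simp add: white_noise_def)
  have si_sum: "square_integrable M (\<lambda>\<omega>. \<Sum>m<N. c m * \<epsilon> (n - int m) \<omega>)"
    by (intro square_integrable_sum square_integrable_cmult si)
  have "(\<integral>\<omega>. (\<Sum>m<N. c m * \<epsilon> (n - int m) \<omega>) * \<epsilon> (n - int i) \<omega> \<partial>M) = c i * s\<^sup>2" if "i < N" for i
    using that
    by (simp add: integral_mult_sum_left si white_noise_integral_mult[OF assms] if_distrib
        cong: if_cong)
  then have inner: "(\<integral>\<omega>. \<epsilon> (n - int i) \<omega> * (\<Sum>m<N. c m * \<epsilon> (n - int m) \<omega>) \<partial>M) = c i * s\<^sup>2"
    if "i < N" for i
    using that by (simp add: mult.commute)
  show ?thesis
    unfolding power2_eq_square[of "sum _ _"]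
    by (subst integral_mult_sum_left)
      (auto simp: si si_sum inner power2_eq_square mult_ac intro!: sum.cong)
qed

lemma backshift_series_integral_noise:
  assumes "white_noise M s \<epsilon>" "backshift_series M b \<epsilon> X"
  shows "(\<integral>\<omega>. X p \<omega> * \<epsilon> q \<omega> \<partial>M) = (if q \<le> p then s\<^sup>2 * b (nat (p - q)) else 0)"
proof -
  have si: "square_integrable M (\<epsilon> i)" for i
    using assms by (simp add: white_noise_def)
  have eq: "(\<integral>\<omega>. (\<Sum>j<N. b j * \<epsilon> (p - int j) \<omega>) * \<epsilon> q \<omega> \<partial>M) =
      (if q \<le> p then s\<^sup>2 * b (nat (p - q)) else 0)" if "N > nat (p - q)" for N
  proof -
    have "(\<integral>\<omega>. (\<Sum>j<N. b j * \<epsilon> (p - int j) \<omega>) * \<epsilon> q \<omega> \<partial>M) =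
        (\<Sum>j<N. if p - int j = q then b j * s\<^sup>2 else 0)"
      by (simp add: integral_mult_sum_left si white_noise_integral_mult[OF assms(1)] if_distrib
          cong: if_cong)
    also have "\<dots> = (\<Sum>j<N. if j = nat (p - q) then (if q \<le> p then s\<^sup>2 * b (nat (p - q)) else 0) else 0)"
      by (rule sum.cong) (auto simp: mult.commute)
    finally show ?thesis using that by simp
  qed
  have "(\<lambda>N. \<integral>\<omega>. (\<Sum>j<N. b j * \<epsilon> (p - int j) \<omega>) * \<epsilon> q \<omega> \<partial>M) \<longlonglongrightarrow> (\<integral>\<omega>. X p \<omega> * \<epsilon> q \<omega> \<partial>M)"
    by (rule tendsto_integral_mult[OF backshift_series_tendsto[OF assms(2)] si])
  moreover have "(\<lambda>N. \<integral>\<omega>. (\<Sum>j<N. b j * \<epsilon> (p - int j) \<omega>) * \<epsilon> q \<omega> \<partial>M) \<longlonglongrightarrow>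
      (if q \<le> p then s\<^sup>2 * b (nat (p - q)) else 0)"
    by (rule tendsto_eventually, rule eventually_mono[OF eventually_gt_at_top eq])
  ultimately show ?thesis by (rule LIMSEQ_unique)
qed

text \<open>The autoregressive and the moving average coefficients are inverse power series. To see this
from the random variables, compute the covariance of \<open>\<epsilon> 0\<close> and \<open>\<epsilon> (- m)\<close> after expanding \<open>\<epsilon> 0\<close> in the
\<open>X (- j)\<close>: the covariance of \<open>X (- j)\<close> and \<open>\<epsilon> (- m)\<close> is \<open>s\<^sup>2 * b (m - j)\<close> for \<open>j \<le> m\<close> and \<open>0\<close> otherwise, so
that only finitely many terms contribute.\<close>

lemma backshift_series_inverse:
  assumes "white_noise M s \<epsilon>" "backshift_series M b \<epsilon> X" "backshift_series M a X \<epsilon>"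
  shows "(\<Sum>j\<le>m. a j * b (m - j)) = (if m = 0 then 1 else 0)"
proof -
  have s: "s > 0" and si: "square_integrable M (\<epsilon> i)" for i
    using assms by (auto simp: white_noise_def)
  have siX: "square_integrable M (X i)" for i
    using assms(2) by (simp add: backshift_series_def mean_square_sums_def)
  let ?q = "- int m"
  have eq: "(\<integral>\<omega>. (\<Sum>j<N. a j * X (0 - int j) \<omega>) * \<epsilon> ?q \<omega> \<partial>M) =
      s\<^sup>2 * (\<Sum>j\<le>m. a j * b (m - j))" if "N > m" for N
  proof -
    have "(\<integral>\<omega>. (\<Sum>j<N. a j * X (0 - int j) \<omega>) * \<epsilon> ?q \<omega> \<partial>M) =
        (\<Sum>j<N. if j \<le> m then a j * (s\<^sup>2 * b (m - j)) else 0)"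
      by (subst integral_mult_sum_left)
        (auto simp: si siX backshift_series_integral_noise[OF assms(1,2)] nat_diff_distrib'
          intro!: sum.cong arg_cong[where f = b])
    also have "\<dots> = (\<Sum>j\<in>{..m}. a j * (s\<^sup>2 * b (m - j)))"
      using that by (intro sum.mono_neutral_cong_right) auto
    finally show ?thesis by (simp add: sum_distrib_left mult_ac)
  qed
  have "(\<lambda>N. \<integral>\<omega>. (\<Sum>j<N. a j * X (0 - int j) \<omega>) * \<epsilon> ?q \<omega> \<partial>M) \<longlonglongrightarrow> (\<integral>\<omega>. \<epsilon> 0 \<omega> * \<epsilon> ?q \<omega> \<partial>M)"
    by (rule tendsto_integral_mult[OF backshift_series_tendsto[OF assms(3)] si])
  moreover have "(\<lambda>N. \<integral>\<omega>. (\<Sum>j<N. a j * X (0 - int j) \<omega>) * \<epsilon> ?q \<omega> \<partial>M) \<longlonglongrightarrow>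
      s\<^sup>2 * (\<Sum>j\<le>m. a j * b (m - j))"
    by (rule tendsto_eventually, rule eventually_mono[OF eventually_gt_at_top eq])
  ultimately have "(\<integral>\<omega>. \<epsilon> 0 \<omega> * \<epsilon> ?q \<omega> \<partial>M) = s\<^sup>2 * (\<Sum>j\<le>m. a j * b (m - j))"
    by (rule LIMSEQ_unique)
  then show ?thesis
    using s by (simp add: white_noise_integral_mult[OF assms(1)] split: if_splits)
qed

text \<open>Delaying the process by \<open>j\<close> shifts its coefficients \<open>j\<close> places to the right. In this form all the
\<open>X (n - j)\<close> are series in the same noise variables \<open>\<epsilon> (n - m)\<close> and can be added term by term.\<close>

lemma backshift_series_delay:
  assumes "white_noise M s \<epsilon>" "backshift_series M b \<epsilon> X"
  shows "mean_square_tendsto M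
    (\<lambda>N \<omega>. \<Sum>m<N. (if j \<le> m then b (m - j) else 0) * \<epsilon> (n - int m) \<omega>) (X (n - int j))"
proof -
  have si: "square_integrable M (\<epsilon> i)" for i
    using assms by (auto simp: white_noise_def)
  have eq: "(\<Sum>m<N + j. (if j \<le> m then b (m - j) else 0) * \<epsilon> (n - int m) \<omega>) =
      (\<Sum>i<N. b i * \<epsilon> (n - int j - int i) \<omega>)" for N \<omega>
  proof -
    have "(\<Sum>m<N + j. (if j \<le> m then b (m - j) else 0) * \<epsilon> (n - int m) \<omega>) =
        (\<Sum>m\<in>{0 + j..<N + j}. b (m - j) * \<epsilon> (n - int m) \<omega>)"
      by (rule sum.mono_neutral_cong_right) auto
    also have "\<dots> = (\<Sum>i<N. b i * \<epsilon> (n - int j - int i) \<omega>)"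
      unfolding sum.shift_bounds_nat_ivl by (auto simp: atLeast0LessThan algebra_simps)
    finally show ?thesis .
  qed
  have tends: "mean_square_tendsto M (\<lambda>N \<omega>. \<Sum>i<N. b i * \<epsilon> (n - int j - int i) \<omega>) (X (n - int j))"
    by (rule backshift_series_tendsto[OF assms(2)])
  have "(\<lambda>N. \<integral>\<omega>. ((\<Sum>m<N. (if j \<le> m then b (m - j) else 0) * \<epsilon> (n - int m) \<omega>)
      - X (n - int j) \<omega>)\<^sup>2 \<partial>M) \<longlonglongrightarrow> 0"
    by (rule LIMSEQ_offset[where k = j]) (use tends in \<open>simp only: eq mean_square_tendsto_def\<close>)
  moreover have "square_integrable M
      (\<lambda>\<omega>. \<Sum>m<N. (if j \<le> m then b (m - j) else 0) * \<epsilon> (n - int m) \<omega>)" for N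
    by (intro square_integrable_sum square_integrable_cmult si)
  ultimately show ?thesis
    using tends by (simp add: mean_square_tendsto_def)
qed

text \<open>Coefficient \<open>m\<close> of the product of the power series of \<open>b\<close> with the polynomial that arises from the
series of \<open>a\<close> by dropping all terms of degree above \<open>k\<close>.\<close>

definition truncated_convolution :: "(nat \<Rightarrow> real) \<Rightarrow> (nat \<Rightarrow> real) \<Rightarrow> nat \<Rightarrow> nat \<Rightarrow> real" where
  "truncated_convolution a b k m = (\<Sum>j\<le>min k m. a j * b (m - j))"

text \<open>Since \<open>a 0 = 1\<close>, the prediction error is the full sum of \<open>a j * X (k + 1 - j)\<close> over \<open>j \<le> k\<close>. Expanded in the
white noise its coefficients are a truncated convolution, and the noise variables are orthogonal.\<close>

lemma prediction_mse_sums: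
  assumes "white_noise M s \<epsilon>" "backshift_series M b \<epsilon> X" "a 0 = 1"
  shows "(\<lambda>m. s\<^sup>2 * (truncated_convolution a b k m)\<^sup>2) sums prediction_mse M a X k"
proof -
  let ?n = "int k + 1"
  have coeff: "truncated_convolution a b k m = (\<Sum>j\<le>k. a j * (if j \<le> m then b (m - j) else 0))" for m
    unfolding truncated_convolution_def by (rule sum.mono_neutral_cong_left) auto
  have "mean_square_tendsto M
      (\<lambda>N \<omega>. \<Sum>j\<le>k. a j * (\<Sum>m<N. (if j \<le> m then b (m - j) else 0) * \<epsilon> (?n - int m) \<omega>))
      (\<lambda>\<omega>. \<Sum>j\<le>k. a j * X (?n - int j) \<omega>)"
    by (intro mean_square_tendsto_sum mean_square_tendsto_cmult
      backshift_series_delay[OF assms(1,2)]) simp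
  moreover have "(\<Sum>j\<le>k. a j * (\<Sum>m<N. (if j \<le> m then b (m - j) else 0) * \<epsilon> (?n - int m) \<omega>))
      = (\<Sum>m<N. truncated_convolution a b k m * \<epsilon> (?n - int m) \<omega>)" for N \<omega>
    unfolding coeff sum_distrib_left sum_distrib_right mult.assoc by (rule sum.swap)
  ultimately have tends: "mean_square_tendsto M
      (\<lambda>N \<omega>. \<Sum>m<N. truncated_convolution a b k m * \<epsilon> (?n - int m) \<omega>)
      (\<lambda>\<omega>. \<Sum>j\<le>k. a j * X (?n - int j) \<omega>)"
    by (simp only:)
  have "X ?n \<omega> - truncated_predictor a X k \<omega> = (\<Sum>j\<le>k. a j * X (?n - int j) \<omega>)" for \<omega>
    by (simp add: truncated_predictor_def sum.atLeast_Suc_atMost[of 0 k] assms(3) atMost_atLeast0)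
  then show ?thesis
    using tendsto_integral_square[OF tends]
    by (simp add: sums_def prediction_mse_def white_noise_square_sum[OF assms(1)])
qed

text \<open>Up to degree \<open>k\<close> the truncation is not felt, so that the coefficients agree with those of the
power series \<open>1\<close>. They contribute the variance \<open>s\<^sup>2\<close> of the innovation, and the excess of the error
over \<open>s\<^sup>2\<close> is a sum of squares over the degrees \<open>m > k\<close>.\<close>

lemma prediction_mse_minus_variance_sums:
  assumes "white_noise M s \<epsilon>" "backshift_series M b \<epsilon> X" "a 0 = 1"
    and inv: "\<And>m. (\<Sum>j\<le>m. a j * b (m - j)) = (if m = 0 then 1 else 0)"
  shows "(\<lambda>l. s\<^sup>2 * (truncated_convolution a b k (l + Suc k))\<^sup>2) sums (prediction_mse M a X k - s\<^sup>2)"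
proof -
  have "(\<Sum>m<Suc k. s\<^sup>2 * (truncated_convolution a b k m)\<^sup>2) = (\<Sum>m<Suc k. if m = 0 then s\<^sup>2 else 0)"
    by (rule sum.cong) (auto simp: truncated_convolution_def min_absorb2 inv)
  also have "\<dots> = s\<^sup>2" by simp
  finally show ?thesis
    using sums_split_initial_segment[OF prediction_mse_sums[of M s \<epsilon> b X a, OF assms(1-3), of k], of "Suc k"]
    by simp
qed

lemma truncated_convolution_tail:
  assumes inv: "\<And>m. (\<Sum>j\<le>m. a j * b (m - j)) = (if m = 0 then 1 else 0)"
  shows "truncated_convolution a b k (l + Suc k) = - (\<Sum>i\<le>l. a (Suc (k + i)) * b (l - i))"
proof -
  have "(\<Sum>j\<le>l + Suc k. a j * b (l + Suc k - j)) =
      (\<Sum>j\<le>k. a j * b (l + Suc k - j)) + (\<Sum>j\<in>{0 + Suc k..l + Suc k}. a j * b (l + Suc k - j))"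
    by (subst sum.union_disjoint[symmetric]) (auto intro!: sum.cong simp del: sum.atMost_Suc)
  also have "(\<Sum>j\<in>{0 + Suc k..l + Suc k}. a j * b (l + Suc k - j)) = (\<Sum>i\<le>l. a (Suc (k + i)) * b (l - i))"
    unfolding sum.shift_bounds_cl_nat_ivl by (simp add: atLeast0AtMost add.commute)
  finally show ?thesis
    using inv[of "l + Suc k"] by (simp add: truncated_convolution_def min_absorb1)
qed

section \<open>Error bound from the decay of the coefficients\<close>

text \<open>Comparison of the sum with the integral of \<open>x powr (- \<beta>)\<close>, one step at a time by the mean value theorem.\<close>

lemma sum_powr_neg_le:
  fixes \<beta> :: real
  assumes "0 < \<beta>" "\<beta> < 1"
  shows "(\<Sum>i\<le>n. real (Suc i) powr (- \<beta>)) \<le> real (Suc n) powr (1 - \<beta>) / (1 - \<beta>)"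
proof (induction n)
  case 0
  then show ?case using assms by simp
next
  case (Suc n)
  let ?x = "real (Suc n)"
  have "\<exists>z>?x. z < ?x + 1 \<and>
      (?x + 1) powr (1 - \<beta>) - ?x powr (1 - \<beta>) = (?x + 1 - ?x) * ((1 - \<beta>) * z powr (- \<beta>))"
  proof (rule MVT2)
    fix x assume "?x \<le> x"
    then show "((\<lambda>x. x powr (1 - \<beta>)) has_real_derivative (1 - \<beta>) * x powr (- \<beta>)) (at x)"
      using has_real_derivative_powr[of x "1 - \<beta>"] by simp
  qed simp
  then obtain z where z: "?x < z" "z < ?x + 1"
    and eq: "(?x + 1) powr (1 - \<beta>) - ?x powr (1 - \<beta>) = (1 - \<beta>) * z powr (- \<beta>)"
    by auto
  have "(?x + 1) powr (- \<beta>) \<le> z powr (- \<beta>)"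
    using z assms by (intro powr_mono2') auto
  also have "\<dots> = ((?x + 1) powr (1 - \<beta>) - ?x powr (1 - \<beta>)) / (1 - \<beta>)"
    using eq assms by simp
  finally have "(?x + 1) powr (- \<beta>) \<le> (?x + 1) powr (1 - \<beta>) / (1 - \<beta>) - ?x powr (1 - \<beta>) / (1 - \<beta>)"
    by (simp add: diff_divide_distrib)
  moreover have "real (Suc (Suc n)) = ?x + 1" by simp
  ultimately show ?case using Suc.IH by simp
qed

lemma powr_neg_half_le:
  fixes x y \<beta> :: real
  assumes "0 < \<beta>" "\<beta> < 1" "0 < x" "x / 2 \<le> y"
  shows "y powr (- \<beta>) \<le> 2 * x powr (- \<beta>)"
proof -
  have "y powr (- \<beta>) \<le> (x / 2) powr (- \<beta>)"
    using assms by (intro powr_mono2') auto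
  also have "\<dots> = 2 powr \<beta> * x powr (- \<beta>)"
    using assms by (simp add: powr_divide powr_minus field_simps)
  also have "\<dots> \<le> 2 powr 1 * x powr (- \<beta>)"
    using assms by (intro mult_right_mono powr_mono) auto
  finally show ?thesis by simp
qed

text \<open>One of the two arguments \<open>i + 1\<close> and \<open>n - i + 1\<close>, whose sum is \<open>n + 2\<close>, is at least half of \<open>n + 1\<close>;
the corresponding power is at most twice that of \<open>n + 1\<close>, and the other power is summed.\<close>

lemma powr_convolution_le:
  fixes \<beta> \<gamma> :: real
  assumes "0 < \<beta>" "\<beta> < 1" "0 < \<gamma>" "\<gamma> < 1"
  shows "(\<Sum>i\<le>n. real (Suc i) powr (- \<beta>) * real (Suc (n - i)) powr (- \<gamma>))
    \<le> (2 / (1 - \<beta>) + 2 / (1 - \<gamma>)) * real (Suc n) powr (1 - \<beta> - \<gamma>)"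
proof -
  let ?x = "real (Suc n)"
  have term_le: "real (Suc i) powr (- \<beta>) * real (Suc (n - i)) powr (- \<gamma>)
      \<le> 2 * ?x powr (- \<gamma>) * real (Suc i) powr (- \<beta>)
        + 2 * ?x powr (- \<beta>) * real (Suc (n - i)) powr (- \<gamma>)" if "i \<le> n" for i
  proof (cases "?x / 2 \<le> real (Suc i)")
    case True
    then have "real (Suc i) powr (- \<beta>) * real (Suc (n - i)) powr (- \<gamma>)
        \<le> 2 * ?x powr (- \<beta>) * real (Suc (n - i)) powr (- \<gamma>)"
      using assms by (intro mult_right_mono powr_neg_half_le) auto
    moreover have "0 \<le> 2 * ?x powr (- \<gamma>) * real (Suc i) powr (- \<beta>)" by simp
    ultimately show ?thesis by linarith
  next
    case False
    then have "?x / 2 \<le> real (Suc (n - i))"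
      using that by (simp add: of_nat_diff field_simps)
    then have "real (Suc i) powr (- \<beta>) * real (Suc (n - i)) powr (- \<gamma>)
        \<le> real (Suc i) powr (- \<beta>) * (2 * ?x powr (- \<gamma>))"
      using assms by (intro mult_left_mono powr_neg_half_le) auto
    moreover have "0 \<le> 2 * ?x powr (- \<beta>) * real (Suc (n - i)) powr (- \<gamma>)" by simp
    ultimately show ?thesis by (simp only: mult_ac)
  qed
  have rev: "(\<Sum>i\<le>n. real (Suc (n - i)) powr (- \<gamma>)) = (\<Sum>i\<le>n. real (Suc i) powr (- \<gamma>))"
    using sum.atLeastAtMost_rev[of "\<lambda>i. real (Suc i) powr (- \<gamma>)" 0 n]
    by (simp add: atLeast0AtMost)
  have "(\<Sum>i\<le>n. real (Suc i) powr (- \<beta>) * real (Suc (n - i)) powr (- \<gamma>))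
      \<le> (\<Sum>i\<le>n. 2 * ?x powr (- \<gamma>) * real (Suc i) powr (- \<beta>)
        + 2 * ?x powr (- \<beta>) * real (Suc (n - i)) powr (- \<gamma>))"
    by (intro sum_mono term_le) simp
  also have "\<dots> = 2 * ?x powr (- \<gamma>) * (\<Sum>i\<le>n. real (Suc i) powr (- \<beta>))
      + 2 * ?x powr (- \<beta>) * (\<Sum>i\<le>n. real (Suc i) powr (- \<gamma>))"
    unfolding sum.distrib sum_distrib_left[symmetric] rev ..
  also have "\<dots> \<le> 2 * ?x powr (- \<gamma>) * (?x powr (1 - \<beta>) / (1 - \<beta>))
      + 2 * ?x powr (- \<beta>) * (?x powr (1 - \<gamma>) / (1 - \<gamma>))"
    using assms by (intro add_mono mult_left_mono sum_powr_neg_le) auto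
  also have "\<dots> = 2 / (1 - \<beta>) * (?x powr (- \<gamma>) * ?x powr (1 - \<beta>))
      + 2 / (1 - \<gamma>) * (?x powr (- \<beta>) * ?x powr (1 - \<gamma>))"
    by simp
  also have "\<dots> = (2 / (1 - \<beta>) + 2 / (1 - \<gamma>)) * ?x powr (1 - \<beta> - \<gamma>)"
    unfolding powr_add[symmetric] by (simp add: algebra_simps)
  finally show ?thesis .
qed

text \<open>The coefficient of degree \<open>k + 1 + l\<close> is, up to sign, a convolution of \<open>a (k + 1 + i)\<close> and \<open>b (l - i)\<close>. The decay of
\<open>a (k + 1 + i)\<close>, of exponent \<open>- d - 1 + h\<close>, is split between \<open>k\<close> and \<open>i\<close>: both are at most \<open>k + 1 + i\<close>.
Giving \<open>i\<close> the exponent \<open>- (1 / 2 + d + 2 * h)\<close> makes the convolution with the decay \<open>d - 1 + h\<close> of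
\<open>b\<close> of order \<open>(l + 1) powr (- 1 / 2 - h)\<close>, which is just square summable. What is left for \<open>k\<close> is the exponent
\<open>- 1 / 2 + 3 * h\<close>, and squaring it gives the rate. The smallness of \<open>h\<close> ensures
\<open>1 / 2 + d + 2 * h < 1\<close> and keeps the exponent of \<open>k\<close> negative.\<close>

lemma prediction_mse_bigo:
  assumes d: "0 < d" "d < 1 / 2"
    and wn: "white_noise M s \<epsilon>" and ma: "backshift_series M b \<epsilon> X"
    and a0: "a 0 = 1" and b0: "b 0 = 1"
    and inv: "\<And>m. (\<Sum>j\<le>m. a j * b (m - j)) = (if m = 0 then 1 else 0)"
    and h: "0 < h" "4 * h < 1 / 2 - d"
    and A: "\<And>j. j \<ge> 1 \<Longrightarrow> \<bar>a j\<bar> \<le> C1 * real j powr (- d - 1 + h)"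
    and B: "\<And>j. j \<ge> 1 \<Longrightarrow> \<bar>b j\<bar> \<le> C2 * real j powr (d - 1 + h)"
  shows "\<exists>K. \<forall>k\<ge>1. \<bar>prediction_mse M a X k - s\<^sup>2\<bar> \<le> K * real k powr (- 1 + 6 * h)"
proof -
  define \<beta> \<gamma> where "\<beta> = 1 / 2 + d + 2 * h" and "\<gamma> = 1 - d - h"
  have \<beta>: "0 < \<beta>" "\<beta> < 1" and \<gamma>: "0 < \<gamma>" "\<gamma> < 1"
    using d h by (auto simp: \<beta>_def \<gamma>_def)
  have C1: "0 \<le> C1" using A[of 1] by simp
  have C2: "0 \<le> C2" using B[of 1] by simp
  have a_le: "\<bar>a (Suc (k + i))\<bar> \<le> C1 * (real k powr (- 1 / 2 + 3 * h) * real (Suc i) powr (- \<beta>))"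
    if "k \<ge> 1" for k i
  proof -
    let ?y = "real (Suc (k + i))"
    have "?y powr (- d - 1 + h) = ?y powr (- 1 / 2 + 3 * h) * ?y powr (- \<beta>)"
      unfolding powr_add[symmetric] by (simp add: \<beta>_def algebra_simps)
    also have "\<dots> \<le> real k powr (- 1 / 2 + 3 * h) * real (Suc i) powr (- \<beta>)"
      using that d h \<beta> by (intro mult_mono powr_mono2') auto
    finally have le: "?y powr (- d - 1 + h) \<le> real k powr (- 1 / 2 + 3 * h) * real (Suc i) powr (- \<beta>)" .
    show ?thesis by (rule order_trans[OF A mult_left_mono[OF le C1]]) simp
  qed
  have b_le: "\<bar>b l\<bar> \<le> (1 + 2 * C2) * real (Suc l) powr (- \<gamma>)" for l
  proof (cases "l = 0")
    case True
    then show ?thesis using C2 by (simp add: b0)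
  next
    case False
    have "\<bar>b l\<bar> \<le> C2 * real l powr (- \<gamma>)"
      using B[of l] False by (simp add: \<gamma>_def algebra_simps)
    also have "\<dots> \<le> C2 * (2 * real (Suc l) powr (- \<gamma>))"
      using C2 \<gamma> False by (intro mult_left_mono powr_neg_half_le) auto
    also have "\<dots> \<le> (1 + 2 * C2) * real (Suc l) powr (- \<gamma>)"
      by (simp add: algebra_simps)
    finally show ?thesis .
  qed
  define D where "D = C1 * (1 + 2 * C2) * (2 / (1 - \<beta>) + 2 / (1 - \<gamma>))"
  have tail: "\<bar>truncated_convolution a b k (l + Suc k)\<bar>
      \<le> D * real k powr (- 1 / 2 + 3 * h) * real (Suc l) powr (- 1 / 2 - h)" if "k \<ge> 1" for k l
  proof -
    have "\<bar>truncated_convolution a b k (l + Suc k)\<bar> \<le> (\<Sum>i\<le>l. \<bar>a (Suc (k + i)) * b (l - i)\<bar>)"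
      unfolding truncated_convolution_tail[of a b k l, OF inv] by (simp add: sum_abs)
    also have "\<dots> \<le> (\<Sum>i\<le>l. C1 * (real k powr (- 1 / 2 + 3 * h) * real (Suc i) powr (- \<beta>))
        * ((1 + 2 * C2) * real (Suc (l - i)) powr (- \<gamma>)))"
      unfolding abs_mult using C1 by (intro sum_mono mult_mono a_le[OF that] b_le) auto
    also have "\<dots> = C1 * (1 + 2 * C2) * real k powr (- 1 / 2 + 3 * h) *
        (\<Sum>i\<le>l. real (Suc i) powr (- \<beta>) * real (Suc (l - i)) powr (- \<gamma>))"
      by (simp add: sum_distrib_left mult_ac)
    also have "\<dots> \<le> C1 * (1 + 2 * C2) * real k powr (- 1 / 2 + 3 * h) *
        ((2 / (1 - \<beta>) + 2 / (1 - \<gamma>)) * real (Suc l) powr (1 - \<beta> - \<gamma>))"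
      using C1 C2 \<beta> \<gamma> by (intro mult_left_mono powr_convolution_le) auto
    also have "\<dots> = D * real k powr (- 1 / 2 + 3 * h) * real (Suc l) powr (- 1 / 2 - h)"
      by (simp add: D_def \<beta>_def \<gamma>_def)
    finally show ?thesis .
  qed
  define T where "T = (\<Sum>l. real (Suc l) powr (- 1 - 2 * h))"
  have summ: "summable (\<lambda>l. real (Suc l) powr (- 1 - 2 * h))"
    using h by (subst summable_Suc_iff) (simp add: summable_real_powr_iff)
  show ?thesis
  proof (intro exI[of _ "s\<^sup>2 * D\<^sup>2 * T"] allI impI)
    fix k :: nat assume k: "k \<ge> 1"
    have sums: "(\<lambda>l. s\<^sup>2 * (truncated_convolution a b k (l + Suc k))\<^sup>2)
        sums (prediction_mse M a X k - s\<^sup>2)"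
      by (rule prediction_mse_minus_variance_sums[of M s \<epsilon> b X a k, OF wn ma a0 inv])
    have le: "s\<^sup>2 * (truncated_convolution a b k (l + Suc k))\<^sup>2
        \<le> s\<^sup>2 * D\<^sup>2 * real k powr (- 1 + 6 * h) * real (Suc l) powr (- 1 - 2 * h)" for l
    proof -
      have sq: "(x powr y)\<^sup>2 = x powr (2 * y)" for x y :: real
        by (simp add: power2_eq_square flip: powr_add)
      have "\<bar>truncated_convolution a b k (l + Suc k)\<bar>\<^sup>2
          \<le> (D * real k powr (- 1 / 2 + 3 * h) * real (Suc l) powr (- 1 / 2 - h))\<^sup>2"
        by (rule power_mono[OF tail[OF k]]) simp
      also have "\<dots> = D\<^sup>2 * real k powr (- 1 + 6 * h) * real (Suc l) powr (- 1 - 2 * h)"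
        unfolding power_mult_distrib sq by (simp add: algebra_simps)
      finally have "s\<^sup>2 * \<bar>truncated_convolution a b k (l + Suc k)\<bar>\<^sup>2
          \<le> s\<^sup>2 * (D\<^sup>2 * real k powr (- 1 + 6 * h) * real (Suc l) powr (- 1 - 2 * h))"
        by (rule mult_left_mono) simp
      then show ?thesis by (simp only: power2_abs mult.assoc)
    qed
    have "prediction_mse M a X k - s\<^sup>2 \<le> s\<^sup>2 * D\<^sup>2 * real k powr (- 1 + 6 * h) * T"
      using sums_le[OF le sums sums_mult[OF summable_sums[OF summ]]] by (simp add: T_def)
    moreover have "0 \<le> prediction_mse M a X k - s\<^sup>2"
      by (rule sums_le[OF _ sums_zero sums]) simp
    ultimately show "\<bar>prediction_mse M a X k - s\<^sup>2\<bar> \<le> s\<^sup>2 * D\<^sup>2 * T * real k powr (- 1 + 6 * h)"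
      by (simp add: mult_ac)
  qed
qed

section \<open>Exact coefficients for fractional noise\<close>

text \<open>Andersen's identity. Partial Vandermonde sums have no closed form in general, but they have one for
two upper arguments with sum \<open>0\<close>. It is found by telescoping: Pascal's rule and absorption express
the summand as the difference of consecutive right-hand sides. For \<open>k = m > 0\<close> the right-hand side vanishes, in accordance with the
identity \<open>(1 + z) powr x * (1 + z) powr (- x) = 1\<close> of power series.\<close>

lemma gbinomial_partial_convolution:
  fixes x :: "'a :: field_char_0"
  assumes "k \<le> m"
  shows "of_nat m * (\<Sum>j\<le>k. (x gchoose j) * (- x gchoose (m - j))) =
    of_nat (m - k) * (x - 1 gchoose k) * (- x gchoose (m - k))"
  using assms
proof (induction k)
  case 0
  then show ?case by simp
next
  case (Suc k)
  define r where "r = m - Suc k"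
  have m: "m = Suc k + r" using Suc.prems by (simp add: r_def)
  define P Q R where "P = (x - 1 gchoose k)" and "Q = (x gchoose Suc k)" and "R = (- x gchoose r)"
  have pascal: "(x - 1 gchoose Suc k) = Q - P"
    using gbinomial_addition_formula[of x k] by (simp add: P_def Q_def)
  have absorb: "of_nat (Suc k) * Q = x * P"
    using gbinomial_absorption[of k x] by (simp add: P_def Q_def)
  have step: "of_nat (Suc r) * (- x gchoose Suc r) = (- x - of_nat r) * R"
    using gbinomial_mult_1[of "- x" r] by (simp add: R_def algebra_simps)
  have "of_nat m * (\<Sum>j\<le>Suc k. (x gchoose j) * (- x gchoose (m - j))) =
      of_nat (m - k) * (x - 1 gchoose k) * (- x gchoose (m - k)) + of_nat m * (Q * R)"
    using Suc by (simp add: distrib_left Q_def R_def r_def)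
  also have "m - k = Suc r" using m by simp
  also have "of_nat (Suc r) * (x - 1 gchoose k) * (- x gchoose Suc r) = P * ((- x - of_nat r) * R)"
    unfolding step[symmetric] by (simp add: P_def mult_ac)
  also have "of_nat m * (Q * R) = (of_nat (Suc k) * Q + of_nat r * Q) * R"
    by (simp add: m algebra_simps)
  also have "P * ((- x - of_nat r) * R) + (of_nat (Suc k) * Q + of_nat r * Q) * R =
      of_nat r * (Q - P) * R"
    unfolding absorb by (simp add: algebra_simps)
  finally show ?case
    by (simp add: pascal R_def r_def)
qed

lemma fractional_ar_coeff_gbinomial:
  assumes "0 < d" "d < 1"
  shows "fractional_ar_coeff d j = (-1) ^ j * (d gchoose j)"
proof -
  have "- d \<notin> \<int>\<^sub>\<le>\<^sub>0"
  proof
    assume "- d \<in> \<int>\<^sub>\<le>\<^sub>0"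
    then obtain n where "- d = - real n" by (auto elim!: nonpos_Ints_cases')
    then show False using assms by (cases n) auto
  qed
  then have "pochhammer (- d) j = Gamma (real j - d) / Gamma (- d)"
    by (simp add: pochhammer_Gamma)
  then show ?thesis
    by (simp add: fractional_ar_coeff_def gbinomial_pochhammer Gamma_fact add.commute
        flip: power_add)
qed

lemma truncated_convolution_gbinomial:
  fixes d :: real
  assumes "k \<le> m" "0 < m"
  shows "truncated_convolution (\<lambda>j. (-1) ^ j * (d gchoose j)) (\<lambda>j. (-1) ^ j * (- d gchoose j)) k m =
    (-1) ^ m * (real (m - k) / real m * (d - 1 gchoose k) * (- d gchoose (m - k)))"
proof -
  have "truncated_convolution (\<lambda>j. (-1) ^ j * (d gchoose j)) (\<lambda>j. (-1) ^ j * (- d gchoose j)) k m =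
      (\<Sum>j\<le>k. (-1) ^ m * ((d gchoose j) * (- d gchoose (m - j))))"
    unfolding truncated_convolution_def
  proof (rule sum.cong)
    fix j assume "j \<in> {..k}"
    then have "(-1 :: real) ^ m = (-1) ^ j * (-1) ^ (m - j)"
      using assms by (simp flip: power_add)
    then show "(-1) ^ j * (d gchoose j) * ((-1) ^ (m - j) * (- d gchoose (m - j))) =
        (-1) ^ m * ((d gchoose j) * (- d gchoose (m - j)))"
      by simp
  qed (use assms in auto)
  also have "\<dots> = (-1) ^ m * (\<Sum>j\<le>k. (d gchoose j) * (- d gchoose (m - j)))"
    by (simp add: sum_distrib_left)
  also have "(\<Sum>j\<le>k. (d gchoose j) * (- d gchoose (m - j))) =
      real (m - k) / real m * (d - 1 gchoose k) * (- d gchoose (m - k))"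
    using gbinomial_partial_convolution[OF assms(1), of d] assms(2) by (simp add: field_simps)
  finally show ?thesis .
qed

text \<open>The index \<open>l\<close> stands for the degree \<open>k + l\<close>. The term \<open>l = 0\<close> is \<open>0\<close> and is included because it lets the
series be read as an integral over \<open>{0..}\<close>.\<close>

lemma fractional_prediction_mse_sums:
  assumes "0 < d" "d < 1" "white_noise M s \<epsilon>"
    and ma: "backshift_series M (\<lambda>j. (-1) ^ j * (- d gchoose j)) \<epsilon> X"
  shows "(\<lambda>l. s\<^sup>2 * (d - 1 gchoose k)\<^sup>2 * ((real l * (- d gchoose l))\<^sup>2 / (real k + real l)\<^sup>2))
    sums (prediction_mse M (fractional_ar_coeff d) X k - s\<^sup>2)"
proof -
  let ?a = "\<lambda>j. (-1) ^ j * (d gchoose j)" and ?b = "\<lambda>j. (-1) ^ j * (- d gchoose j)"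
  let ?f = "\<lambda>l. s\<^sup>2 * (d - 1 gchoose k)\<^sup>2 * ((real l * (- d gchoose l))\<^sup>2 / (real k + real l)\<^sup>2)"
  have a: "fractional_ar_coeff d = ?a"
    using assms fractional_ar_coeff_gbinomial by auto
  have inv: "(\<Sum>j\<le>m. ?a j * ?b (m - j)) = (if m = 0 then 1 else 0)" for m
    using truncated_convolution_gbinomial[of m m d]
    by (cases "m = 0") (simp_all add: truncated_convolution_def)
  have "(\<lambda>l. s\<^sup>2 * (truncated_convolution ?a ?b k (l + Suc k))\<^sup>2)
      sums (prediction_mse M ?a X k - s\<^sup>2)"
    by (rule prediction_mse_minus_variance_sums[OF assms(3) ma _ inv]) simp
  moreover have "s\<^sup>2 * (truncated_convolution ?a ?b k (l + Suc k))\<^sup>2 =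
      s\<^sup>2 * (d - 1 gchoose k)\<^sup>2 * ((real (Suc l) * (- d gchoose Suc l))\<^sup>2 / (real k + real (Suc l))\<^sup>2)" for l
    by (subst truncated_convolution_gbinomial)
      (simp_all add: Suc_diff_le power_mult_distrib power_divide add_ac flip: power_mult)
  ultimately have "(\<lambda>l. ?f (Suc l)) sums (prediction_mse M ?a X k - s\<^sup>2)"
    by (simp only:)
  from sums_Suc[of ?f, OF this] show ?thesis by (simp add: a)
qed

section \<open>Asymptotics of the error series\<close>

lemma gbinomial_mult_powr_tendsto:
  fixes z :: real
  shows "(\<lambda>n. (-1) ^ n * (z gchoose n) * real n powr (z + 1)) \<longlonglongrightarrow> inverse (Gamma (- z))"
proof (rule Lim_transform_eventually[OF gbinomial_asymptotic[of z]])
  show "\<forall>\<^sub>F n in sequentially. (z gchoose n) / ((-1) ^ n / exp ((z + 1) * of_real (ln (real n)))) =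
      (-1) ^ n * (z gchoose n) * real n powr (z + 1)"
    using eventually_gt_at_top[of 0]
  proof eventually_elim
    case (elim n)
    then show ?case
      by (cases "even n") (simp_all add: powr_def)
  qed
qed

text \<open>The step function \<open>x \<mapsto> f (nat \<lfloor>k * x\<rfloor>)\<close> takes the value \<open>f l\<close> on an interval of length \<open>1 / k\<close>. This turns
the series into an integral, to which dominated convergence applies after rescaling.\<close>

lemma sums_scaled_integral_floor:
  fixes f :: "nat \<Rightarrow> real"
  assumes k: "0 < k" and f: "\<And>l. 0 \<le> f l"
    and int: "integrable lborel (\<lambda>x::real. indicator {0..} x * f (nat \<lfloor>k * x\<rfloor>))"
  shows "f sums (k * (\<integral>x. indicator {0..} x * f (nat \<lfloor>k * x\<rfloor>) \<partial>lborel))"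
proof -
  let ?F = "\<lambda>x::real. indicator {0..} x * f (nat \<lfloor>k * x\<rfloor>)"
  let ?I = "\<lambda>l. {real l / k..<(real l + 1) / k}"
  have cell: "x \<in> ?I l \<longleftrightarrow> 0 \<le> x \<and> nat \<lfloor>k * x\<rfloor> = l" for x l
  proof -
    have "x \<in> ?I l \<longleftrightarrow> real l \<le> k * x \<and> k * x < real l + 1"
      using k by (simp add: field_simps)
    also have "\<dots> \<longleftrightarrow> \<lfloor>k * x\<rfloor> = int l"
      by (simp add: floor_eq_iff)
    also have "\<dots> \<longleftrightarrow> 0 \<le> k * x \<and> nat \<lfloor>k * x\<rfloor> = l"
      by (auto simp: nat_eq_iff simp flip: zero_le_floor)
    finally show ?thesis using k by (simp add: zero_le_mult_iff)
  qed
  have step: "ennreal (?F x) = (\<Sum>l. ennreal (f l) * indicator (?I l) x)" for x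
  proof (cases "0 \<le> x")
    case True
    then have ind: "(indicator (?I l) x :: ennreal) = of_bool (nat \<lfloor>k * x\<rfloor> = l)" for l
      unfolding indicator_def cell by simp
    have "(\<Sum>l. ennreal (f l) * indicator (?I l) x) =
        (\<Sum>l\<in>{nat \<lfloor>k * x\<rfloor>}. ennreal (f l) * indicator (?I l) x)"
      unfolding ind by (rule suminf_finite) auto
    then show ?thesis using True unfolding ind by simp
  next
    case False
    then have "(indicator (?I l) x :: ennreal) = 0" for l
      unfolding indicator_def cell by simp
    then show ?thesis using False by simp
  qed
  have "ennreal (\<integral>x. ?F x \<partial>lborel) = (\<integral>\<^sup>+x. ennreal (?F x) \<partial>lborel)"
    using int f by (intro nn_integral_eq_integral[symmetric]) auto
  also have "\<dots> = (\<Sum>l. \<integral>\<^sup>+x. ennreal (f l) * indicator (?I l) x \<partial>lborel)"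
    unfolding step by (rule nn_integral_suminf) simp
  also have "\<dots> = (\<Sum>l. ennreal (f l / k))"
  proof -
    have "(\<integral>\<^sup>+x. ennreal (f l) * indicator (?I l) x \<partial>lborel) = ennreal (f l / k)" for l
      using k f[of l] by (simp add: nn_integral_cmult divide_right_mono flip: ennreal_mult diff_divide_distrib)
    then show ?thesis by simp
  qed
  finally have "(\<lambda>l. ennreal (f l / k)) sums ennreal (\<integral>x. ?F x \<partial>lborel)"
    using summable_sums[OF summableI, of "\<lambda>l. ennreal (f l / k)"] by simp
  then have "(\<lambda>l. f l / k) sums (\<integral>x. ?F x \<partial>lborel)"
    using f k by (subst (asm) sums_ennreal) auto
  from sums_mult[OF this, of k] show ?thesis using k by simp
qed

lemma powr_over_square_integrable:
  fixes \<theta> :: real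
  assumes "0 \<le> \<theta>" "\<theta> < 1"
  shows "integrable lborel (\<lambda>x. indicator {0..} x * (x powr \<theta> / (1 + x)\<^sup>2))"
proof (rule Bochner_Integration.integrable_bound)
  let ?G = "\<lambda>x::real. indicator {0..} x * (1 + x) powr (\<theta> - 2)"
  let ?P = "\<lambda>x::real. - ((1 + x) powr (\<theta> - 1)) / (1 - \<theta>)"
  have "(\<integral>\<^sup>+x. ennreal ((1 + x) powr (\<theta> - 2)) * indicator {0..} x \<partial>lborel) = ennreal (0 - ?P 0)"
  proof (rule nn_integral_FTC_atLeast[where F = ?P and T = 0])
    fix x :: real assume "0 \<le> x"
    have "DERIV (\<lambda>x. (1 + x) powr (\<theta> - 1)) x :> (\<theta> - 1) * (1 + x) powr (\<theta> - 1 - 1) * 1"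
      by (rule DERIV_chain2[where f = "\<lambda>z. z powr (\<theta> - 1)", OF has_real_derivative_powr])
        (use \<open>0 \<le> x\<close> in \<open>auto intro!: derivative_eq_intros\<close>)
    then have "DERIV ?P x :> - ((\<theta> - 1) * (1 + x) powr (\<theta> - 1 - 1) * 1) / (1 - \<theta>)"
      by (intro DERIV_cdivide DERIV_minus)
    moreover have "- ((\<theta> - 1) * (1 + x) powr (\<theta> - 1 - 1) * 1) / (1 - \<theta>) = (1 + x) powr (\<theta> - 2)"
      using assms by (simp add: field_simps)
    ultimately show "DERIV ?P x :> (1 + x) powr (\<theta> - 2)" by (simp only:)
  next
    have "filterlim (\<lambda>x::real. 1 + x) at_top at_top"
      by (rule filterlim_tendsto_add_at_top[OF tendsto_const filterlim_ident])
    then have "((\<lambda>x::real. (1 + x) powr (\<theta> - 1)) \<longlongrightarrow> 0) at_top"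
      using assms by (intro tendsto_neg_powr) auto
    from tendsto_divide[OF tendsto_minus[OF this] tendsto_const[of "1 - \<theta>"]]
    show "(?P \<longlongrightarrow> 0) at_top" using assms by simp
  qed auto
  then have "(\<integral>\<^sup>+x. ennreal (?G x) \<partial>lborel) = ennreal (0 - ?P 0)"
    by (simp add: indicator_mult_ennreal mult.commute)
  then show "integrable lborel ?G"
    by (intro integrableI_nonneg) auto
  show "(\<lambda>x::real. indicator {0..} x * (x powr \<theta> / (1 + x)\<^sup>2)) \<in> borel_measurable lborel"
    by measurable
  have "x powr \<theta> / (1 + x)\<^sup>2 \<le> (1 + x) powr (\<theta> - 2)" if "0 \<le> x" for x :: real
  proof -
    have "x powr \<theta> / (1 + x)\<^sup>2 \<le> (1 + x) powr \<theta> / (1 + x)\<^sup>2"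
      using that assms by (intro divide_right_mono powr_mono2) auto
    also have "\<dots> = (1 + x) powr (\<theta> - 2)"
      using that by (simp add: powr_diff)
    finally show ?thesis .
  qed
  then show "AE x in lborel. norm (indicator {0..} x * (x powr \<theta> / (1 + x)\<^sup>2)) \<le> norm (?G x)"
    by (auto simp: indicator_def)
qed

lemma powr_over_square_integral_pos:
  fixes \<theta> :: real
  assumes "0 \<le> \<theta>" "\<theta> < 1"
  shows "0 < (\<integral>x. indicator {0..} x * (x powr \<theta> / (1 + x)\<^sup>2) \<partial>lborel)"
proof -
  have "0 < (\<integral>x. indicator {1..2::real} x * (1 / 9 :: real) \<partial>lborel)" by simp
  also have "\<dots> \<le> (\<integral>x. indicator {0..} x * (x powr \<theta> / (1 + x)\<^sup>2) \<partial>lborel)"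
  proof (rule integral_mono)
    fix x :: real
    have "1 / 9 \<le> x powr \<theta> / (1 + x)\<^sup>2" if "1 \<le> x" "x \<le> 2"
    proof -
      have "(1 + x)\<^sup>2 \<le> 3\<^sup>2" using that by (intro power_mono) auto
      then show ?thesis
        using that assms ge_one_powr_ge_zero[of x \<theta>] by (intro frac_le) auto
    qed
    then show "indicator {1..2} x * (1 / 9) \<le> indicator {0..} x * (x powr \<theta> / (1 + x)\<^sup>2)"
      by (auto simp: indicator_def)
  qed (use powr_over_square_integrable[OF assms] in auto)
  finally show ?thesis .
qed

lemma real_nat_floor_bounds:
  fixes y :: real
  assumes "0 \<le> y"
  shows "real (nat \<lfloor>y\<rfloor>) \<le> y" "y - 1 \<le> real (nat \<lfloor>y\<rfloor>)"
proof -
  have "real (nat \<lfloor>y\<rfloor>) = of_int \<lfloor>y\<rfloor>" using assms by simp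
  then show "real (nat \<lfloor>y\<rfloor>) \<le> y" "y - 1 \<le> real (nat \<lfloor>y\<rfloor>)"
    using floor_correct[of y] by linarith+
qed

text \<open>After the substitution \<open>l = k * x\<close>, the left-hand side is the integral of a step function that
converges pointwise to \<open>c * x powr \<theta> / (1 + x)\<^sup>2\<close>. It is dominated by a multiple of \<open>x powr \<theta> / (1 + x)\<^sup>2\<close>:
\<open>u l\<close> is at most a constant times \<open>l powr \<theta>\<close>, and \<open>k + \<lfloor>k * x\<rfloor>\<close> is at least half of \<open>k * (1 + x)\<close>.\<close>

lemma weighted_series_asymptotics:
  fixes u :: "nat \<Rightarrow> real" and \<theta> c :: real
  assumes \<theta>: "0 < \<theta>" "\<theta> < 1" and u: "\<And>l. 0 \<le> u l" "u 0 = 0"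
    and lim: "(\<lambda>l. u l / real l powr \<theta>) \<longlonglongrightarrow> c"
  shows "(\<lambda>k. real k powr (1 - \<theta>) * (\<Sum>l. u l / (real k + real l)\<^sup>2))
    \<longlonglongrightarrow> c * (\<integral>x. indicator {0..} x * (x powr \<theta> / (1 + x)\<^sup>2) \<partial>lborel)"
proof -
  let ?g = "\<lambda>x::real. indicator {0..} x * (x powr \<theta> / (1 + x)\<^sup>2)"
  let ?n = "\<lambda>k x. nat \<lfloor>real (Suc k) * x\<rfloor>"
  define f where "f k l = real (Suc k) powr (2 - \<theta>) * (u l / (real (Suc k) + real l)\<^sup>2)" for k l
  define h where "h k x = indicator {0..} x * f k (?n k x)" for k and x :: real
  obtain K where "\<And>l. norm (u l / real l powr \<theta>) \<le> K"
    using convergent_imp_Bseq[OF convergentI[OF lim]] unfolding Bseq_def by auto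
  then have K: "u l / real l powr \<theta> \<le> K" for l
    by (metis abs_le_D1 real_norm_def)
  have u_le: "u l \<le> K * real l powr \<theta>" for l
    using K[of l] u by (cases "l = 0") (auto simp: field_simps)
  have "0 \<le> K" using K[of 0] by simp
  have scale: "q powr (2 - \<theta>) * (4 * (K * (q * x) powr \<theta>) / (q * y)\<^sup>2) = 4 * K * (x powr \<theta> / y\<^sup>2)"
    if "0 < q" "0 \<le> x" "0 < y" for q x y :: real
    using that by (simp add: powr_mult powr_diff power_mult_distrib)
  have rescale: "v / m powr \<theta> * ((m / q) powr \<theta> / (1 + m / q)\<^sup>2) = q powr (2 - \<theta>) * (v / (q + m)\<^sup>2)"
    if "0 < q" "0 < m" for q m v :: real
  proof -
    have "1 + m / q = (q + m) / q" using that by (simp add: field_simps)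
    then show ?thesis
      using that by (simp add: powr_divide powr_diff power_divide)
  qed
  have meas: "h k \<in> borel_measurable lborel" for k
    unfolding h_def by measurable
  have bound: "norm (h k x) \<le> 4 * K * ?g x" for k x
  proof (cases "0 \<le> x")
    case True
    let ?k = "real (Suc k)" and ?m = "real (?n k x)"
    have m: "?m \<le> ?k * x" "?k * x - 1 \<le> ?m"
      using True real_nat_floor_bounds[of "?k * x"] by auto
    \<comment> \<open>\<open>q\<close> absorbs the rounding error because \<open>1 \<le> q\<close>.\<close>
    have "q * (1 + x) \<le> 2 * (q + p)" if "1 \<le> q" "0 \<le> p" "q * x - 1 \<le> p" for p q :: real
      using that by (simp add: distrib_left)
    from this[OF _ _ m(2)] have "?k * (1 + x) \<le> 2 * (?k + ?m)" by simp
    then have sq: "(?k * (1 + x))\<^sup>2 \<le> (2 * (?k + ?m))\<^sup>2"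
      using True by (intro power_mono) auto
    have "u (?n k x) / (?k + ?m)\<^sup>2 = 4 * u (?n k x) / (2 * (?k + ?m))\<^sup>2"
      unfolding power_mult_distrib by simp
    also have "\<dots> \<le> 4 * (K * (?k * x) powr \<theta>) / (?k * (1 + x))\<^sup>2"
    proof (rule frac_le)
      have "u (?n k x) \<le> K * ?m powr \<theta>" by (rule u_le)
      also have "\<dots> \<le> K * (?k * x) powr \<theta>"
        using m \<theta> \<open>0 \<le> K\<close> by (intro mult_left_mono powr_mono2) auto
      finally show "4 * u (?n k x) \<le> 4 * (K * (?k * x) powr \<theta>)" by simp
    qed (use sq True \<open>0 \<le> K\<close> in auto)
    finally have "f k (?n k x) \<le> ?k powr (2 - \<theta>) * (4 * (K * (?k * x) powr \<theta>) / (?k * (1 + x))\<^sup>2)"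
      unfolding f_def by (rule mult_left_mono) simp
    also have "\<dots> = 4 * K * (x powr \<theta> / (1 + x)\<^sup>2)"
      by (rule scale) (use True in auto)
    finally show ?thesis
      using True u by (simp add: h_def f_def)
  qed (simp add: h_def)
  have pointwise: "(\<lambda>k. h k x) \<longlonglongrightarrow> c * ?g x" for x
  proof (cases "0 < x")
    case True
    have k_top: "filterlim (\<lambda>k. real (Suc k)) at_top sequentially"
      by (rule filterlim_compose[OF filterlim_real_sequentially filterlim_Suc])
    have n_top: "filterlim (\<lambda>k. ?n k x) at_top sequentially"
    proof -
      have "filterlim (\<lambda>k. real (Suc k) * x) at_top sequentially"
        using True by (intro filterlim_at_top_mult_tendsto_pos[OF tendsto_const _ k_top]) auto
      then show ?thesis
        by (intro filterlim_compose[OF filterlim_nat_sequentially]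
            filterlim_compose[OF filterlim_floor_sequentially])
    qed
    have ratio: "(\<lambda>k. real (?n k x) / real (Suc k)) \<longlonglongrightarrow> x"
    proof (rule tendsto_sandwich)
      have "(\<lambda>k. x - 1 / real (Suc k)) \<longlonglongrightarrow> x - 0"
        by (intro tendsto_diff tendsto_const LIMSEQ_Suc[OF lim_1_over_n])
      then show "(\<lambda>k. x - 1 / real (Suc k)) \<longlonglongrightarrow> x" by simp
      have lower: "x - 1 / q \<le> p / q" if "0 < q" "q * x - 1 \<le> p" for p q :: real
        using that divide_right_mono[of "q * x - 1" p q] by (simp add: diff_divide_distrib)
      have upper: "p / q \<le> x" if "0 < q" "p \<le> q * x" for p q :: real
        using that by (simp add: pos_divide_le_eq mult.commute)
      show "\<forall>\<^sub>F k in sequentially. x - 1 / real (Suc k) \<le> real (?n k x) / real (Suc k)"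
        using True by (intro always_eventually allI lower real_nat_floor_bounds) auto
      show "\<forall>\<^sub>F k in sequentially. real (?n k x) / real (Suc k) \<le> x"
        using True by (intro always_eventually allI upper real_nat_floor_bounds) auto
    qed simp
    have "(\<lambda>k. u (?n k x) / real (?n k x) powr \<theta> *
        ((real (?n k x) / real (Suc k)) powr \<theta> / (1 + real (?n k x) / real (Suc k))\<^sup>2))
        \<longlonglongrightarrow> c * (x powr \<theta> / (1 + x)\<^sup>2)"
      using True by (intro tendsto_intros filterlim_compose[OF lim n_top] ratio) auto
    moreover have "\<forall>\<^sub>F k in sequentially. u (?n k x) / real (?n k x) powr \<theta> *
        ((real (?n k x) / real (Suc k)) powr \<theta> / (1 + real (?n k x) / real (Suc k))\<^sup>2) = h k x"
      using eventually_compose_filterlim[OF eventually_gt_at_top[of 0] n_top]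
    proof eventually_elim
      case (elim k)
      let ?k = "real (Suc k)" and ?m = "real (?n k x)"
      have "u (?n k x) / ?m powr \<theta> * ((?m / ?k) powr \<theta> / (1 + ?m / ?k)\<^sup>2)
          = ?k powr (2 - \<theta>) * (u (?n k x) / (?k + ?m)\<^sup>2)"
        using elim by (intro rescale) auto
      also have "\<dots> = h k x"
        using True by (simp add: h_def f_def)
      finally show ?case .
    qed
    ultimately have "(\<lambda>k. h k x) \<longlonglongrightarrow> c * (x powr \<theta> / (1 + x)\<^sup>2)"
      by (rule Lim_transform_eventually)
    then show ?thesis using True by simp
  next
    case False
    then have "x < 0 \<or> x = 0" by auto
    then show ?thesis
      using \<theta> by (auto simp: h_def f_def u)
  qed
  have dom: "integrable lborel (\<lambda>x. 4 * K * ?g x)"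
    using \<theta> by (intro integrable_mult_right powr_over_square_integrable) auto
  have int: "integrable lborel (h k)" for k
    by (rule Bochner_Integration.integrable_bound[OF dom meas]) (use bound \<open>0 \<le> K\<close> in auto)
  have "(\<lambda>k. \<integral>x. h k x \<partial>lborel) \<longlonglongrightarrow> (\<integral>x. c * ?g x \<partial>lborel)"
    by (rule integral_dominated_convergence[OF _ meas dom]) (use pointwise bound in auto)
  moreover have "(\<integral>x. h k x \<partial>lborel) =
      real (Suc k) powr (1 - \<theta>) * (\<Sum>l. u l / (real (Suc k) + real l)\<^sup>2)" for k
  proof -
    have h_eq: "h k = (\<lambda>x. indicator {0..} x * f k (?n k x))"
      by (simp add: h_def fun_eq_iff)
    have "f k sums (real (Suc k) * (\<integral>x. h k x \<partial>lborel))"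
      unfolding h_eq
      by (rule sums_scaled_integral_floor[OF _ _ int[of k, unfolded h_eq]]) (simp_all add: f_def u)
    then have "(\<lambda>l. real (Suc k) powr (\<theta> - 2) * f k l) sums
        (real (Suc k) powr (\<theta> - 2) * (real (Suc k) * (\<integral>x. h k x \<partial>lborel)))"
      by (rule sums_mult)
    moreover have "real (Suc k) powr (\<theta> - 2) * f k l = u l / (real (Suc k) + real l)\<^sup>2" for l
      unfolding f_def mult.assoc[symmetric] powr_add[symmetric] by simp
    moreover have "real (Suc k) powr (\<theta> - 2) * (real (Suc k) * (\<integral>x. h k x \<partial>lborel)) =
        real (Suc k) powr (\<theta> - 1) * (\<integral>x. h k x \<partial>lborel)"
      by (simp add: powr_diff power2_eq_square)
    ultimately have "(\<Sum>l. u l / (real (Suc k) + real l)\<^sup>2) = real (Suc k) powr (\<theta> - 1) * (\<integral>x. h k x \<partial>lborel)"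
      by (simp add: sums_iff)
    then have "real (Suc k) powr (1 - \<theta>) * (\<Sum>l. u l / (real (Suc k) + real l)\<^sup>2) =
        real (Suc k) powr (1 - \<theta>) * real (Suc k) powr (\<theta> - 1) * (\<integral>x. h k x \<partial>lborel)"
      by simp
    also have "real (Suc k) powr (1 - \<theta>) * real (Suc k) powr (\<theta> - 1) = 1"
      by (simp flip: powr_add)
    finally show ?thesis by simp
  qed
  moreover have "(\<integral>x. c * ?g x \<partial>lborel) = c * (\<integral>x. ?g x \<partial>lborel)"
    by (rule integral_mult_right_zero)
  ultimately have "(\<lambda>k. real (Suc k) powr (1 - \<theta>) * (\<Sum>l. u l / (real (Suc k) + real l)\<^sup>2))
      \<longlonglongrightarrow> c * (\<integral>x. ?g x \<partial>lborel)"
    by (simp only:)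
  then show ?thesis
    by (rule LIMSEQ_imp_Suc[where f = "\<lambda>k. real k powr (1 - \<theta>) * (\<Sum>l. u l / (real k + real l)\<^sup>2)"])
qed

text \<open>The exact series has the prefactor \<open>(d - 1 gchoose k)\<^sup>2\<close> of order \<open>k powr (- 2 * d)\<close>, while the series itself
is of order \<open>k powr (2 * d - 1)\<close>. The constant is
\<open>C = s\<^sup>2 * J / (Gamma d * Gamma (1 - d))\<^sup>2\<close> with the positive integral \<open>J\<close> of \<open>x powr (2 * d) / (1 + x)\<^sup>2\<close>
over \<open>{0..}\<close>.\<close>

lemma fractional_prediction_mse_tendsto:
  assumes d: "0 < d" "d < 1 / 2" and "white_noise M s \<epsilon>"
    and "backshift_series M (\<lambda>j. (-1) ^ j * (- d gchoose j)) \<epsilon> X"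
  shows "\<exists>C. C \<noteq> 0 \<and>
    (\<lambda>k. real k * (prediction_mse M (fractional_ar_coeff d) X k - s\<^sup>2)) \<longlonglongrightarrow> C"
proof -
  define u where "u l = (real l * (- d gchoose l))\<^sup>2" for l
  define S where "S k = (\<Sum>l. u l / (real k + real l)\<^sup>2)" for k
  define J where "J = (\<integral>x. indicator {0..} x * (x powr (2 * d) / (1 + x)\<^sup>2) \<partial>lborel)"
  have sq: "(x powr y)\<^sup>2 = x powr (2 * y)" for x y :: real
    by (simp add: power2_eq_square flip: powr_add)
  have sgn: "((- 1 :: real) ^ n)\<^sup>2 = 1" for n
    by (simp flip: power_mult)
  have "(\<lambda>l. ((-1) ^ l * (- d gchoose l) * real l powr (1 - d))\<^sup>2) \<longlonglongrightarrow> (inverse (Gamma d))\<^sup>2"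
    using gbinomial_mult_powr_tendsto[of "- d"] by (intro tendsto_power) simp
  moreover have "\<forall>\<^sub>F l in sequentially.
      ((-1) ^ l * (- d gchoose l) * real l powr (1 - d))\<^sup>2 = u l / real l powr (2 * d)"
    using eventually_gt_at_top[of 0]
    by eventually_elim (simp add: u_def power_mult_distrib sgn powr_diff power_divide sq)
  ultimately have "(\<lambda>l. u l / real l powr (2 * d)) \<longlonglongrightarrow> (inverse (Gamma d))\<^sup>2"
    by (rule Lim_transform_eventually)
  then have S: "(\<lambda>k. real k powr (1 - 2 * d) * S k) \<longlonglongrightarrow> (inverse (Gamma d))\<^sup>2 * J"
    unfolding S_def J_def using d by (intro weighted_series_asymptotics) (auto simp: u_def)
  have P: "(\<lambda>k. ((-1) ^ k * (d - 1 gchoose k) * real k powr d)\<^sup>2) \<longlonglongrightarrow> (inverse (Gamma (1 - d)))\<^sup>2"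
    using gbinomial_mult_powr_tendsto[of "d - 1"] by (intro tendsto_power) simp
  have lim: "(\<lambda>k. s\<^sup>2 * (((-1) ^ k * (d - 1 gchoose k) * real k powr d)\<^sup>2 * (real k powr (1 - 2 * d) * S k)))
      \<longlonglongrightarrow> s\<^sup>2 * ((inverse (Gamma (1 - d)))\<^sup>2 * ((inverse (Gamma d))\<^sup>2 * J))"
    by (intro tendsto_mult tendsto_const S P)
  have "s\<^sup>2 * (((-1) ^ k * (d - 1 gchoose k) * real k powr d)\<^sup>2 * (real k powr (1 - 2 * d) * S k)) =
      real k * (prediction_mse M (fractional_ar_coeff d) X k - s\<^sup>2)" for k
  proof (cases "k = 0")
    case False
    have sums: "(\<lambda>l. s\<^sup>2 * (d - 1 gchoose k)\<^sup>2 * (u l / (real k + real l)\<^sup>2))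
        sums (prediction_mse M (fractional_ar_coeff d) X k - s\<^sup>2)"
      unfolding u_def by (rule fractional_prediction_mse_sums) (use assms in auto)
    \<comment> \<open>Summability of the unscaled series is extracted from the known sum, so the factor must not vanish.\<close>
    have "s > 0" using assms by (simp add: white_noise_def)
    moreover have "(d - 1 gchoose k) \<noteq> 0"
      using d by (auto simp: gbinomial_prod_rev)
    ultimately have "summable (\<lambda>l. u l / (real k + real l)\<^sup>2)"
      using sums_summable[OF sums] by (subst (asm) summable_cmult_iff) auto
    then have "(\<lambda>l. s\<^sup>2 * (d - 1 gchoose k)\<^sup>2 * (u l / (real k + real l)\<^sup>2))
        sums (s\<^sup>2 * (d - 1 gchoose k)\<^sup>2 * S k)"
      unfolding S_def by (intro sums_mult summable_sums)
    then have "prediction_mse M (fractional_ar_coeff d) X k - s\<^sup>2 = s\<^sup>2 * (d - 1 gchoose k)\<^sup>2 * S k"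
      by (rule sums_unique2[OF sums])
    moreover have "(real k powr d)\<^sup>2 * real k powr (1 - 2 * d) = real k"
      unfolding sq powr_add[symmetric] using False by simp
    ultimately show ?thesis
      by (simp add: power_mult_distrib sgn mult_ac)
  qed simp
  with lim have "(\<lambda>k. real k * (prediction_mse M (fractional_ar_coeff d) X k - s\<^sup>2))
      \<longlonglongrightarrow> s\<^sup>2 * ((inverse (Gamma (1 - d)))\<^sup>2 * ((inverse (Gamma d))\<^sup>2 * J))"
    by simp
  moreover have "J > 0"
    unfolding J_def using d by (intro powr_over_square_integral_pos) auto
  moreover have "Gamma d > 0" "Gamma (1 - d) > 0" "s > 0"
    using d assms by (auto intro: Gamma_real_pos simp: white_noise_def)
  ultimately show ?thesis
    by (intro exI conjI) auto
qed

section \<open>Rate of convergence of the prediction error\<close>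

theorem proposition2p1p1:
  fixes M :: "'a measure" and X \<epsilon> :: "int \<Rightarrow> 'a \<Rightarrow> real"
    and a b :: "nat \<Rightarrow> real" and d s :: real
  assumes "prob_space M" and "0 < d" and "d < 1 / 2"
  shows
    "(long_memory_linear_process M s X \<epsilon> a b \<and>
       (\<forall>\<delta>>0. \<exists>C1 C2. \<forall>j\<ge>1.
          \<bar>a j\<bar> \<le> C1 * real j powr (- d - 1 + \<delta>) \<and>
          \<bar>b j\<bar> \<le> C2 * real j powr (d - 1 + \<delta>))
       \<longrightarrow> (\<forall>\<delta>>0. (\<lambda>k. prediction_mse M a X k - s\<^sup>2) \<in> O(\<lambda>k. real k powr (- 1 + \<delta>))))
     \<and>
     (fractional_noise M d s X \<epsilon>
       \<longrightarrow> (\<exists>C. C \<noteq> 0 \<and>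
             (\<lambda>k. prediction_mse M (fractional_ar_coeff d) X k - (s\<^sup>2 + C / real k))
               \<in> o(\<lambda>k. 1 / real k)))"
proof (intro conjI impI allI)
  fix \<delta> :: real
  assume "long_memory_linear_process M s X \<epsilon> a b \<and>
       (\<forall>\<delta>>0. \<exists>C1 C2. \<forall>j\<ge>1.
          \<bar>a j\<bar> \<le> C1 * real j powr (- d - 1 + \<delta>) \<and>
          \<bar>b j\<bar> \<le> C2 * real j powr (d - 1 + \<delta>))"
    and \<delta>: "\<delta> > 0"
  then have wn: "white_noise M s \<epsilon>" and ma: "backshift_series M b \<epsilon> X"
    and ar: "backshift_series M a X \<epsilon>" and a0: "a 0 = 1" and b0: "b 0 = 1"
    and decay: "\<And>\<delta>. \<delta> > 0 \<Longrightarrow> \<exists>C1 C2. \<forall>j\<ge>1.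
          \<bar>a j\<bar> \<le> C1 * real j powr (- d - 1 + \<delta>) \<and> \<bar>b j\<bar> \<le> C2 * real j powr (d - 1 + \<delta>)"
    by (auto simp: long_memory_linear_process_def)
  \<comment> \<open>The bound loses \<open>6 * h\<close> in the exponent, and it needs \<open>4 * h < 1 / 2 - d\<close>.\<close>
  define h where "h = min (\<delta> / 6) ((1 / 2 - d) / 5)"
  have h: "0 < h" "4 * h < 1 / 2 - d" "6 * h \<le> \<delta>"
    using \<delta> assms by (auto simp: h_def min_def)
  obtain C1 C2 where "\<And>j. j \<ge> 1 \<Longrightarrow> \<bar>a j\<bar> \<le> C1 * real j powr (- d - 1 + h)"
    and "\<And>j. j \<ge> 1 \<Longrightarrow> \<bar>b j\<bar> \<le> C2 * real j powr (d - 1 + h)"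
    using decay[OF h(1)] by blast
  from prediction_mse_bigo[OF assms(2,3) wn ma a0 b0 backshift_series_inverse[OF wn ma ar] h(1,2) this]
  obtain K where K: "\<And>k. k \<ge> 1 \<Longrightarrow> \<bar>prediction_mse M a X k - s\<^sup>2\<bar> \<le> K * real k powr (- 1 + 6 * h)"
    by blast
  have "\<bar>prediction_mse M a X k - s\<^sup>2\<bar> \<le> \<bar>K\<bar> * real k powr (- 1 + \<delta>)" if "k \<ge> 1" for k
  proof -
    have "\<bar>prediction_mse M a X k - s\<^sup>2\<bar> \<le> K * real k powr (- 1 + 6 * h)" by (rule K[OF that])
    also have "\<dots> \<le> \<bar>K\<bar> * real k powr (- 1 + \<delta>)"
      using h that by (intro mult_mono powr_mono) auto
    finally show ?thesis .
  qed
  then show "(\<lambda>k. prediction_mse M a X k - s\<^sup>2) \<in> O(\<lambda>k. real k powr (- 1 + \<delta>))"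
    by (intro bigoI[of _ "\<bar>K\<bar>"] eventually_mono[OF eventually_ge_at_top[of 1]]) auto
next
  assume "fractional_noise M d s X \<epsilon>"
  then obtain C where "C \<noteq> 0"
    and lim: "(\<lambda>k. real k * (prediction_mse M (fractional_ar_coeff d) X k - s\<^sup>2)) \<longlonglongrightarrow> C"
    using fractional_prediction_mse_tendsto[OF assms(2,3), of M s \<epsilon> X] by (auto simp: fractional_noise_def)
  have "(\<lambda>k. (prediction_mse M (fractional_ar_coeff d) X k - (s\<^sup>2 + C / real k)) / (1 / real k)) \<longlonglongrightarrow> 0"
  proof (rule Lim_transform_eventually)
    show "(\<lambda>k. real k * (prediction_mse M (fractional_ar_coeff d) X k - s\<^sup>2) - C) \<longlonglongrightarrow> 0"
      using lim by (rule LIM_zero)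
    show "\<forall>\<^sub>F k in sequentially. real k * (prediction_mse M (fractional_ar_coeff d) X k - s\<^sup>2) - C =
        (prediction_mse M (fractional_ar_coeff d) X k - (s\<^sup>2 + C / real k)) / (1 / real k)"
      using eventually_gt_at_top[of 0] by eventually_elim (simp add: field_simps)
  qed
  then have "(\<lambda>k. prediction_mse M (fractional_ar_coeff d) X k - (s\<^sup>2 + C / real k)) \<in> o(\<lambda>k. 1 / real k)"
    by (intro smalloI_tendsto eventually_mono[OF eventually_gt_at_top[of 0]]) auto
  with \<open>C \<noteq> 0\<close> show "\<exists>C. C \<noteq> 0 \<and>
      (\<lambda>k. prediction_mse M (fractional_ar_coeff d) X k - (s\<^sup>2 + C / real k)) \<in> o(\<lambda>k. 1 / real k)"
    by blast
qed

end
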